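(* Let $Y_1,Y_2$ be independent positive random variables and let $L_1,L_2,p_1,p_2$ be positive constants. Define $$A=\Bigl(\frac{p_1L_1}{p_2L_2}\Bigr)^{1/(p_1+p_2)},\qquad B=L_1A^{-p_1}+L_2A^{p_2}.$$ (a) If for $i=1,2$ $$\lim_{u\to\infty}\frac{\log \mathbb{P}(Y_i>u)}{u^{p_i}}=-L_i,$$ then $$\lim_{u\to\infty}\frac{\log\mathbb{P}(Y_1Y_2>u)}{u^{p_1p_2/(p_1+p_2)}}=-B.$$ (b) If for $i=1,2$ $$\mathbb{P}(Y_i>u)\sim g_i(u)\exp(-L_iu^{p_i}),\qquad u\to\infty,$$ where $g_1,g_2$ are functions regularly varying at infinity, then with $$c_u=Au^{p_1/(p_1+p_2)},\qquad D=\Biggl(\frac{2\pi (p_1L_1)^{\frac{p_2}{p_1+p_2}}(p_2L_2)^{\frac{p_1}{p_1+p_2}}}{p_1+p_2}\Biggr)^{1/2},$$ we have, as $u\to\infty$, $$\mathbb{P}(Y_1Y_2>u)\sim D\,u^{\frac{p_1p_2}{2(p_1+p_2)}}\,g_1(u/c_u)\,g_2(c_u)\exp\Bigl(-Bu^{\frac{p_1p_2}{p_1+p_2}}\Bigr)\sim D\,u^{\frac{p_1p_2}{2(p_1+p_2)}}\,\mathbb{P}(Y_1>u/c_u)\,\mathbb{P}(Y_2>c_u).$$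
   Context: $f_1(u)\sim f_2(u)$ means $\lim_{u\to\infty}f_1(u)/f_2(u)=1$. *)

theory Defs
  imports "HOL-Probability.Probability" "HOL-Library.Landau_Symbols"
begin

text \<open>Regular variation at infinity (Bingham--Goldie--Teugels): g is a Borel measurable
function, eventually positive, and for every t > 0 the ratio g(t u)/g(u) converges
(necessarily to t powr rho for some index rho).\<close>
definition regularly_varying :: "(real \<Rightarrow> real) \<Rightarrow> bool" where
  "regularly_varying g \<longleftrightarrow>
     g \<in> borel_measurable borel \<and>
     (\<forall>\<^sub>F u in at_top. g u > 0) \<and>
     (\<exists>\<rho>::real. \<forall>t>0. ((\<lambda>u. g (t * u) / g u) \<longlongrightarrow> t powr \<rho>) at_top)"

end

theory Submission
  imports Defs "HOL-Real_Asymp.Real_Asymp"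
begin

text \<open>
  In logarithmic coordinates the product becomes a sum \<open>X1 + X2\<close> whose tails decay like
  \<open>exp (- K / p1 * exp (p1 * x))\<close> and \<open>exp (- K / p2 * exp (p2 * x))\<close>. With \<open>\<lambda> = exp l\<close> the event is
  \<open>X1 + X2 > l / p1 + l / p2\<close>, and the contribution of \<open>X2 = l / p2 + t\<close> has exponent
  \<open>- \<lambda> * (K / p1 * exp (- p1 * t) + K / p2 * exp (p2 * t))\<close>, which is maximal at \<open>t = 0\<close> with value \<open>- B * \<lambda>\<close>.
  Exponential moments of \<open>\<theta> * K / p * exp (p * X)\<close> with \<open>\<theta> < 1\<close> give a Chernoff bound showing that \<open>t\<close> away from 0 is
  exponentially negligible; with the trivial lower bound \<open>P(X1 > l / p1) * P(X2 > l / p2)\<close> this already yields (a).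
  For (b), regular variation is locally uniform in \<open>t\<close>, so near 0 the factors \<open>g1, g2\<close> may be frozen.
  Integration by parts replaces the law of \<open>X2\<close> by its tail, and Laplace's method evaluates the remaining integral.
\<close>

subsection \<open>Uniform convergence for regularly varying functions\<close>

text \<open>No density is assumed, and a tail known up to a factor \<open>1 + o(1)\<close> cannot be
  differentiated. The smooth model of the tail of \<open>X1\<close> is therefore the factor that
  gets differentiated, while the law of \<open>X2\<close> enters through its tail alone; the price
  is boundary terms at the edges of the window. On the logarithmic scale this window around the
  saddle point has a half-width \<open>d\<close> that does not depend on \<open>l\<close>. The
  exponential moments are available for \<theta> < 1, so the Chernoff bound loses a factor in the
  exponent. In (a) this is harmless because \<theta> may be taken arbitrarily close to 1. In (b) the
  bound is applied outside the window, where the phase exceeds \<open>B\<close> by a fixed amount,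
  and a suitable \<theta> still leaves an exponent larger than \<open>B\<close>. The surplus beats
  the regularly varying factors, which are \<open>exp (o (exp l))\<close>. Freezing these factors
  costs powers of \<open>exp e\<close>. The limit in \<open>l\<close> is taken for fixed
  \<open>e\<close>, and \<open>e\<close> tends to 0 afterwards, so \<open>d\<close> may depend on
  \<open>e\<close>.\<close>

lemma eventually_measure_gt_of_incseq_Union:
  fixes V :: "nat \<Rightarrow> real set"
  assumes meas: "\<And>n. V n \<in> sets borel" and inc: "incseq V" and un: "(\<Union>n. V n) = {a..b}"
    and c: "c < b - a" "a \<le> b"
  shows "\<forall>\<^sub>F n in sequentially. c < measure lborel (V n)"
proof -
  have "(\<lambda>n. emeasure lborel (V n)) \<longlonglongrightarrow> emeasure lborel (\<Union>n. V n)"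
    using meas inc by (intro Lim_emeasure_incseq) auto
  then have "(\<lambda>n. emeasure lborel (V n)) \<longlonglongrightarrow> ennreal (b - a)"
    unfolding un using c by simp
  then have "(\<lambda>n. measure lborel (V n)) \<longlonglongrightarrow> b - a"
    unfolding measure_def by (rule tendsto_enn2real) (use c in auto)
  then show ?thesis
    by (rule order_tendstoD) (use c in auto)
qed

text \<open>Steinhaus-type argument. Along the two sequences \<open>x n\<close> and
  \<open>x n + t n\<close>, pointwise convergence makes most shifts good. A point reached from both
  by good shifts yields two increments below \<open>e / 2\<close>, whose difference is the increment
  that was supposed to be at least \<open>e\<close>.\<close>

lemma uniform_translation_limit:
  fixes f :: "real \<Rightarrow> real"
  assumes meas: "f \<in> borel_measurable borel"
    and lim: "\<And>t. ((\<lambda>x. f (x + t) - f x) \<longlongrightarrow> 0) at_top"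
    and e: "e > 0"
  shows "\<exists>x0. \<forall>x\<ge>x0. \<forall>t\<in>{0..1}. \<bar>f (x + t) - f x\<bar> < e"
proof (rule ccontr)
  assume "\<not> ?thesis"
  then have "\<forall>n::nat. \<exists>x t. x \<ge> real n \<and> t \<in> {0..1} \<and> \<bar>f (x + t) - f x\<bar> \<ge> e"
    by (meson not_le)
  then obtain x t where xt: "\<And>n. x n \<ge> real n" "\<And>n. t n \<in> {0..1}"
      "\<And>n. \<bar>f (x n + t n) - f (x n)\<bar> \<ge> e"
    by metis
  \<comment> \<open>Since the offsets \<open>t n\<close> fill an interval of length 1, shifts from
    an interval of length 2 suffice: two sets of measure close to 2 cannot be disjoint inside length
    3. The condition for all \<open>m \<ge> n\<close> makes the sets increase with \<open>n\<close>,
    and pointwise convergence makes them exhaust \<open>{0..2}\<close>.\<close>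
  define U where "U y n = {s\<in>{0..2}. \<forall>m\<ge>n. \<bar>f (y m + s) - f (y m)\<bar> < e / 2}"
    for y :: "nat \<Rightarrow> real" and n :: nat
  have U: "\<forall>\<^sub>F n in sequentially. 3 / 2 < measure lborel (U y n)" "\<And>n. U y n \<in> sets borel"
    if y: "\<And>n. y n \<ge> real n" for y
  proof -
    have top: "filterlim y at_top sequentially"
      using filterlim_at_top_mono[OF filterlim_real_sequentially] y by simp
    show m: "\<And>n. U y n \<in> sets borel"
      unfolding U_def using meas by measurable
    have "s \<in> (\<Union>n. U y n)" if s: "s \<in> {0..2}" for s
    proof -
      have "\<forall>\<^sub>F m in sequentially. \<bar>f (y m + s) - f (y m)\<bar> < e / 2"
        using tendstoD[OF filterlim_compose[OF lim[of s] top], of "e/2"] e by (simp add: dist_real_def)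
      then show ?thesis
        using s by (auto simp: U_def eventually_sequentially)
    qed
    then have "(\<Union>n. U y n) = {0..2}" by (auto simp: U_def)
    moreover have "incseq (U y)"
      by (auto simp: incseq_def U_def)
    ultimately show "\<forall>\<^sub>F n in sequentially. 3 / 2 < measure lborel (U y n)"
      using m by (intro eventually_measure_gt_of_incseq_Union[where a = 0 and b = 2]) auto
  qed
  have y: "x n + t n \<ge> real n" for n using xt(1)[of n] xt(2)[of n] by auto
  obtain n where n: "3 / 2 < measure lborel (U x n)" "3 / 2 < measure lborel (U (\<lambda>n. x n + t n) n)"
    using eventually_happens'[OF _ eventually_conj[OF U(1)[OF xt(1)] U(1)[OF y]]] by auto
  let ?V = "U x n" and ?W = "(+) (t n) ` U (\<lambda>n. x n + t n) n"
  have sub: "?W \<subseteq> {0..3}" "?V \<subseteq> {0..3}"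
    using xt(2)[of n] by (auto simp: U_def)
  have fin: "?V \<in> fmeasurable lborel" "?W \<in> fmeasurable lborel"
  proof -
    have *: "?W = (\<lambda>s. s - t n) -` U (\<lambda>n. x n + t n) n"
      by (auto simp: image_iff) (metis add.commute diff_add_cancel)
    have "?W \<in> sets borel"
      unfolding * using measurable_sets_borel[OF _ U(2)[OF y], of "\<lambda>s. s - t n"] by simp
    then show "?V \<in> fmeasurable lborel" "?W \<in> fmeasurable lborel"
      using U(2)[OF xt(1)] sub fmeasurable_cbox(1)[of 0 "3::real"]
      by (auto intro: fmeasurableI2[of "{0..3}" lborel])
  qed
  have W: "measure lborel ?W = measure lborel (U (\<lambda>n. x n + t n) n)"
  proof -
    have "measure lborel ?W = measure lebesgue ?W"
      using fmeasurableD[OF fin(2)] by (subst measure_completion) auto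
    also have "\<dots> = measure lebesgue (U (\<lambda>n. x n + t n) n)"
      by (rule measure_translation)
    also have "\<dots> = measure lborel (U (\<lambda>n. x n + t n) n)"
      using U(2)[OF y] by (subst measure_completion) auto
    finally show ?thesis .
  qed
  \<comment> \<open>Both sets lie in an interval of length 3 and have measure above 3/2.\<close>
  have "?V \<inter> ?W \<noteq> {}"
  proof
    assume "?V \<inter> ?W = {}"
    then have "measure lborel (?V \<union> ?W) = measure lborel ?V + measure lborel ?W"
      using measure_Un3[OF fin] by simp
    moreover have "measure lborel (?V \<union> ?W) \<le> measure lborel {0..3::real}"
      using fmeasurableD[OF fin(1)] fmeasurableD[OF fin(2)] sub fmeasurable_cbox(1)[of 0 "3::real"]
      by (intro measure_mono_fmeasurable) simp_all
    ultimately show False using n W by simp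
  qed
  then obtain s where s: "t n + s \<in> ?V" "s \<in> U (\<lambda>n. x n + t n) n"
    by blast
  have "\<bar>f (x n + (t n + s)) - f (x n)\<bar> < e / 2"
    using s(1) by (auto simp: U_def)
  moreover have "\<bar>f (x n + t n + s) - f (x n + t n)\<bar> < e / 2"
    using s(2) by (auto simp: U_def)
  ultimately show False using xt(3)[of n] unfolding add.assoc by linarith
qed

lemma linear_growth_of_bounded_increments:
  fixes k :: "real \<Rightarrow> real"
  assumes step: "\<And>x t. x \<ge> x0 \<Longrightarrow> 0 \<le> t \<Longrightarrow> t \<le> 1 \<Longrightarrow> \<bar>k (x + t) - k x\<bar> \<le> C"
    and x: "x \<ge> x0"
  shows "\<bar>k x\<bar> \<le> \<bar>k x0\<bar> + C * (x - x0 + 1)"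
proof -
  have C: "C \<ge> 0" using step[of x0 0] by simp
  have n: "\<bar>k (x0 + real n) - k x0\<bar> \<le> C * real n" for n
  proof (induction n)
    case (Suc n)
    then show ?case
      using step[of "x0 + real n" 1] by (simp add: algebra_simps)
  qed simp
  define n where "n = nat \<lfloor>x - x0\<rfloor>"
  have n1: "real n \<le> x - x0" "x - x0 \<le> real n + 1"
    using x unfolding n_def by linarith+
  have "\<bar>k (x0 + real n + (x - x0 - real n)) - k (x0 + real n)\<bar> \<le> C"
    using n1 by (intro step) auto
  then have "\<bar>k x - k x0\<bar> \<le> C * (real n + 1)"
    using n[of n] by (simp add: algebra_simps)
  also have "\<dots> \<le> C * (x - x0 + 1)"
    using n1 C by (intro mult_left_mono) auto
  finally show ?thesis by simp
qed

text \<open>Here \<open>k\<close> stands for the logarithm of a regularly varying function in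
  logarithmic coordinates. Subtracting \<rho> * x reduces to increments tending to 0, where uniform
  convergence applies. Bounded increments over unit steps give at most linear growth, which any
  exponential beats.\<close>

lemma
  fixes k :: "real \<Rightarrow> real"
  assumes meas: "k \<in> borel_measurable borel"
    and lim: "\<And>t. ((\<lambda>x. k (x + t) - k x) \<longlongrightarrow> \<rho> * t) at_top"
  shows regular_increments_locally_uniform:
      "e > 0 \<Longrightarrow> \<exists>d>0. \<forall>\<^sub>F x in at_top. \<forall>t. \<bar>t\<bar> \<le> d \<longrightarrow> \<bar>k (x + t) - k x\<bar> \<le> e"
    and regular_increments_negligible: "p > 0 \<Longrightarrow> ((\<lambda>x. k x / exp (p * x)) \<longlongrightarrow> 0) at_top"
proof -
  define f where "f x = k x - \<rho> * x" for x
  have fm: "f \<in> borel_measurable borel" unfolding f_def using meas by measurable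
  have fl: "((\<lambda>x. f (x + t) - f x) \<longlongrightarrow> 0) at_top" for t
    using tendsto_diff[OF lim[of t] tendsto_const[of "\<rho> * t"]]
    by (simp add: f_def algebra_simps)
  have unif: "\<exists>x0. \<forall>x\<ge>x0. \<forall>t\<in>{0..1}. \<bar>k (x + t) - k x - \<rho> * t\<bar> < e" if "e > 0" for e
    using uniform_translation_limit[OF fm fl that] by (simp add: f_def algebra_simps)
  show "\<exists>d>0. \<forall>\<^sub>F x in at_top. \<forall>t. \<bar>t\<bar> \<le> d \<longrightarrow> \<bar>k (x + t) - k x\<bar> \<le> e" if e: "e > 0"
  proof -
    from unif[of "e / 2"] e obtain x0
      where "\<forall>x\<ge>x0. \<forall>t\<in>{0..1}. \<bar>k (x + t) - k x - \<rho> * t\<bar> < e / 2"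
      by fastforce
    then have x0: "\<And>x t. x \<ge> x0 \<Longrightarrow> 0 \<le> t \<Longrightarrow> t \<le> 1 \<Longrightarrow> \<bar>k (x + t) - k x - \<rho> * t\<bar> < e / 2"
      by simp
    \<comment> \<open>Half of \<open>e\<close> is reserved for the linear part \<rho> * t. The bound
      \<open>d \<le> 1\<close> keeps \<open>t\<close> in the range of the uniform estimate and lets
      a negative \<open>t\<close> be treated by starting from \<open>x + t\<close>.\<close>
    define d where "d = min 1 (e / (2 * (\<bar>\<rho>\<bar> + 1)))"
    have d: "d > 0" "d \<le> 1" using e by (auto simp: d_def)
    have "\<bar>\<rho>\<bar> * d \<le> (\<bar>\<rho>\<bar> + 1) * (e / (2 * (\<bar>\<rho>\<bar> + 1)))"
      using d(1) by (intro mult_mono) (auto simp: d_def)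
    also have "\<dots> = e / 2" by (simp add: field_simps)
    finally have rd: "\<bar>\<rho>\<bar> * d \<le> e / 2" .
    have pos: "\<bar>k (x + t) - k x\<bar> \<le> e" if "x \<ge> x0" "0 \<le> t" "t \<le> d" for x t
    proof -
      have "\<bar>\<rho> * t\<bar> \<le> \<bar>\<rho>\<bar> * d" using that by (simp add: abs_mult mult_left_mono)
      then show ?thesis using x0[of x t] that d rd by (simp add: abs_if split: if_splits)
    qed
    have "\<bar>k (x + t) - k x\<bar> \<le> e" if "x \<ge> x0 + 1" "\<bar>t\<bar> \<le> d" for x t
    proof (cases "t \<ge> 0")
      case True
      then show ?thesis using pos[of x t] that by auto
    next
      case False
      then show ?thesis using pos[of "x + t" "- t"] that d by (auto simp: abs_minus_commute)
    qed
    then have "\<forall>\<^sub>F x in at_top. \<forall>t. \<bar>t\<bar> \<le> d \<longrightarrow> \<bar>k (x + t) - k x\<bar> \<le> e"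
      by (intro eventually_mono[OF eventually_ge_at_top[of "x0 + 1"]]) blast
    then show ?thesis using d(1) by blast
  qed
  show "((\<lambda>x. k x / exp (p * x)) \<longlongrightarrow> 0) at_top" if p: "p > 0"
  proof -
    from unif[of 1] obtain x0
      where "\<forall>x\<ge>x0. \<forall>t\<in>{0..1}. \<bar>k (x + t) - k x - \<rho> * t\<bar> < 1"
      by fastforce
    then have x0: "\<And>x t. x \<ge> x0 \<Longrightarrow> 0 \<le> t \<Longrightarrow> t \<le> 1 \<Longrightarrow> \<bar>k (x + t) - k x - \<rho> * t\<bar> < 1"
      by simp
    have st: "\<bar>k (x + t) - k x\<bar> \<le> \<bar>\<rho>\<bar> + 1" if "x \<ge> x0" "0 \<le> t" "t \<le> 1" for x t
    proof -
      have "\<bar>\<rho> * t\<bar> \<le> \<bar>\<rho>\<bar> * 1" using that unfolding abs_mult by (intro mult_left_mono) auto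
      then show ?thesis using x0[of x t] that by (simp add: abs_if split: if_splits)
    qed
    note bd = linear_growth_of_bounded_increments[of x0 k, OF st]
    define C where "C = \<bar>\<rho>\<bar> + 1"
    have "((\<lambda>x. (\<bar>k x0\<bar> + C * (x - x0 + 1)) / exp (p * x)) \<longlongrightarrow> 0) at_top"
      using p by real_asymp
    moreover have "\<forall>\<^sub>F x in at_top. norm (k x / exp (p * x)) \<le> (\<bar>k x0\<bar> + C * (x - x0 + 1)) / exp (p * x)"
      using eventually_ge_at_top[of x0]
    proof eventually_elim
      case (elim x)
      show ?case using bd[OF _ _ _ elim] by (simp add: C_def divide_right_mono)
    qed
    ultimately show ?thesis
      by (rule Lim_null_comparison[rotated])
  qed
qed

subsection \<open>Layer-cake formulas and exponential moments\<close>

lemma (in prob_space) nn_integral_indep_var: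
  fixes X Y :: "'a \<Rightarrow> real"
  assumes ind: "indep_var borel X borel Y" and f: "f \<in> borel_measurable (borel \<Otimes>\<^sub>M borel)"
  shows "(\<integral>\<^sup>+\<omega>. f (X \<omega>, Y \<omega>) \<partial>M) = (\<integral>\<^sup>+\<omega>'. \<integral>\<^sup>+\<omega>. f (X \<omega>, Y \<omega>') \<partial>M \<partial>M)"
proof -
  note [measurable] = f indep_var_rv1[OF ind] indep_var_rv2[OF ind]
  interpret X: prob_space "distr M borel X" by (rule prob_space_distr) simp
  interpret Y: prob_space "distr M borel Y" by (rule prob_space_distr) simp
  interpret XY: pair_sigma_finite "distr M borel X" "distr M borel Y" ..
  have "(\<integral>\<^sup>+\<omega>. f (X \<omega>, Y \<omega>) \<partial>M) = (\<integral>\<^sup>+z. f z \<partial>distr M (borel \<Otimes>\<^sub>M borel) (\<lambda>\<omega>. (X \<omega>, Y \<omega>)))"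
    by (subst nn_integral_distr) auto
  also have "\<dots> = (\<integral>\<^sup>+z. f z \<partial>(distr M borel X \<Otimes>\<^sub>M distr M borel Y))"
    using ind by (simp add: indep_var_distribution_eq)
  also have "\<dots> = (\<integral>\<^sup>+y. \<integral>\<^sup>+x. f (x, y) \<partial>distr M borel X \<partial>distr M borel Y)"
    by (rule XY.nn_integral_snd[symmetric]) (use f in simp)
  also have "\<dots> = (\<integral>\<^sup>+\<omega>'. \<integral>\<^sup>+\<omega>. f (X \<omega>, Y \<omega>') \<partial>M \<partial>M)"
    by (subst nn_integral_distr, simp, measurable) (simp add: nn_integral_distr)
  finally show ?thesis .
qed

lemma (in sigma_finite_measure) nn_integral_layer_cake:
  fixes X :: "'a \<Rightarrow> real" and f :: "real \<Rightarrow> ennreal"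
  assumes [measurable]: "X \<in> borel_measurable M" "f \<in> borel_measurable borel"
  shows "(\<integral>\<^sup>+\<omega>. (\<integral>\<^sup>+t. f t * indicator {..<X \<omega>} t \<partial>lborel) \<partial>M)
    = (\<integral>\<^sup>+t. f t * emeasure M {\<omega>\<in>space M. t < X \<omega>} \<partial>lborel)"
proof -
  interpret P: pair_sigma_finite lborel M ..
  have "(\<integral>\<^sup>+\<omega>. (\<integral>\<^sup>+t. f t * indicator {..<X \<omega>} t \<partial>lborel) \<partial>M)
      = (\<integral>\<^sup>+t. (\<integral>\<^sup>+\<omega>. f t * indicator {..<X \<omega>} t \<partial>M) \<partial>lborel)"
    by (rule P.Fubini') (simp add: indicator_def of_bool_def, measurable)
  also have "\<dots> = (\<integral>\<^sup>+t. f t * emeasure M {\<omega>\<in>space M. t < X \<omega>} \<partial>lborel)"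
  proof (rule nn_integral_cong)
    fix t :: real
    have "(\<integral>\<^sup>+\<omega>. f t * indicator {..<X \<omega>} t \<partial>M) = (\<integral>\<^sup>+\<omega>. f t * indicator {\<omega>\<in>space M. t < X \<omega>} \<omega> \<partial>M)"
      by (rule nn_integral_cong) (auto simp: indicator_def)
    then show "(\<integral>\<^sup>+\<omega>. f t * indicator {..<X \<omega>} t \<partial>M) = f t * emeasure M {\<omega>\<in>space M. t < X \<omega>}"
      by (simp add: nn_integral_cmult_indicator)
  qed
  finally show ?thesis .
qed

lemma nn_integral_FTC_Ico:
  fixes f F :: "real \<Rightarrow> real"
  assumes "f \<in> borel_measurable borel"
    and "\<And>x. DERIV F x :> f x" "\<And>x. 0 \<le> f x" "a \<le> b"
  shows "(\<integral>\<^sup>+x. ennreal (f x) * indicator {a..<b} x \<partial>lborel) = ennreal (F b - F a)"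
proof -
  have "(\<integral>\<^sup>+x. ennreal (f x) * indicator {a..<b} x \<partial>lborel) = (\<integral>\<^sup>+x. ennreal (f x) * indicator {a..b} x \<partial>lborel)"
    using AE_lborel_singleton[of b]
    by (intro nn_integral_cong_AE) (auto elim!: eventually_mono simp: indicator_def)
  also have "\<dots> = ennreal (F b - F a)"
    using assms by (intro nn_integral_FTC_Icc) auto
  finally show ?thesis .
qed

text \<open>The layer-cake formula for \<open>F\<close> cut off at \<open>b\<close> gives the exact
  identity \<open>N + F(a) P(a < X) = J + F(b) P(b < X)\<close>. Each inequality drops one boundary
  term of it. The form suits \<open>ennreal\<close>, where subtraction is best avoided, and the
  surviving boundary terms turn out negligible in the application.\<close>

lemma (in prob_space) integration_by_parts_window:
  fixes X :: "'a \<Rightarrow> real" and f F :: "real \<Rightarrow> real"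
  assumes X[measurable]: "X \<in> borel_measurable M" and f[measurable]: "f \<in> borel_measurable borel"
    and F: "\<And>x. DERIV F x :> f x" "\<And>x. 0 \<le> f x" "\<And>x. 0 \<le> F x" and ab: "a \<le> b"
  defines "J \<equiv> (\<integral>\<^sup>+\<omega>. ennreal (F (X \<omega>)) * indicator {a<..b} (X \<omega>) \<partial>M)"
    and "N \<equiv> (\<integral>\<^sup>+t. ennreal (f t) * indicator {a..b} t * emeasure M {\<omega>\<in>space M. t < X \<omega>} \<partial>lborel)"
  shows "J \<le> ennreal (F a) * emeasure M {\<omega>\<in>space M. a < X \<omega>} + N"
    and "N \<le> J + ennreal (F b) * emeasure M {\<omega>\<in>space M. b < X \<omega>}"
proof -
  have mono: "F x \<le> F y" if "x \<le> y" for x y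
    using F(1,2) that by (meson DERIV_nonneg_imp_nondecreasing)
  have [measurable]: "F \<in> borel_measurable borel"
    using F(1) by (intro borel_measurable_continuous_onI)
      (auto intro!: DERIV_isCont continuous_at_imp_continuous_on)
  define I where "I \<omega> = (\<integral>\<^sup>+t. (ennreal (f t) * indicator {a..b} t) * indicator {..<X \<omega>} t \<partial>lborel)" for \<omega>
  have N: "N = (\<integral>\<^sup>+\<omega>. I \<omega> \<partial>M)"
    unfolding N_def I_def by (rule nn_integral_layer_cake[symmetric]) auto
  have I[measurable]: "I \<in> borel_measurable M"
    unfolding I_def by (simp add: indicator_def of_bool_def, measurable)
  have I_eq: "I \<omega> = ennreal (F (min b (X \<omega>)) - F a)" if "a < X \<omega>" for \<omega>
  proof (cases "X \<omega> \<le> b")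
    case True
    have "I \<omega> = (\<integral>\<^sup>+t. ennreal (f t) * indicator {a..<X \<omega>} t \<partial>lborel)"
      unfolding I_def using True by (intro nn_integral_cong) (auto simp: indicator_def)
    then show ?thesis using True that F by (simp add: nn_integral_FTC_Ico)
  next
    case False
    have "I \<omega> = (\<integral>\<^sup>+t. ennreal (f t) * indicator {a..b} t \<partial>lborel)"
      unfolding I_def using False by (intro nn_integral_cong) (auto simp: indicator_def)
    also have "\<dots> = ennreal (F b - F a)" using F ab by (intro nn_integral_FTC_Icc) auto
    finally show ?thesis using False by simp
  qed
  have I_0: "I \<omega> = 0" if "X \<omega> \<le> a" for \<omega>
  proof -
    have "I \<omega> = (\<integral>\<^sup>+t. 0 \<partial>(lborel :: real measure))"
      unfolding I_def using that by (intro nn_integral_cong) (auto simp: indicator_def)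
    then show ?thesis by simp
  qed
  have "J \<le> (\<integral>\<^sup>+\<omega>. ennreal (F a) * indicator {\<omega>\<in>space M. a < X \<omega>} \<omega> + I \<omega> \<partial>M)"
    unfolding J_def
  proof (rule nn_integral_mono)
    fix \<omega> assume "\<omega> \<in> space M"
    then show "ennreal (F (X \<omega>)) * indicator {a<..b} (X \<omega>)
        \<le> ennreal (F a) * indicator {\<omega>\<in>space M. a < X \<omega>} \<omega> + I \<omega>"
      using F(3) mono by (cases "a < X \<omega> \<and> X \<omega> \<le> b") (auto simp: I_eq indicator_def simp flip: ennreal_plus)
  qed
  also have "\<dots> = ennreal (F a) * emeasure M {\<omega>\<in>space M. a < X \<omega>} + N"
    by (subst nn_integral_add) (auto simp: N nn_integral_cmult_indicator)
  finally show "J \<le> ennreal (F a) * emeasure M {\<omega>\<in>space M. a < X \<omega>} + N" .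
  have "N \<le> (\<integral>\<^sup>+\<omega>. ennreal (F (X \<omega>)) * indicator {a<..b} (X \<omega>) + ennreal (F b) * indicator {\<omega>\<in>space M. b < X \<omega>} \<omega> \<partial>M)"
    unfolding N
  proof (rule nn_integral_mono)
    fix \<omega> assume "\<omega> \<in> space M"
    then show "I \<omega> \<le> ennreal (F (X \<omega>)) * indicator {a<..b} (X \<omega>) + ennreal (F b) * indicator {\<omega>\<in>space M. b < X \<omega>} \<omega>"
      using F(3)[of a] by (cases "a < X \<omega>"; cases "X \<omega> \<le> b") (auto simp: I_eq I_0 indicator_def intro!: ennreal_leI)
  qed
  also have "\<dots> = J + ennreal (F b) * emeasure M {\<omega>\<in>space M. b < X \<omega>}"
    by (subst nn_integral_add) (auto simp: J_def nn_integral_cmult_indicator)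
  finally show "N \<le> J + ennreal (F b) * emeasure M {\<omega>\<in>space M. b < X \<omega>}" .
qed

text \<open>The gap 1 - \<theta> is split in half by \<eta>. Eventually the tail is at most
  \<open>exp (- ((\<theta> + \<eta>) * \<alpha>) * exp (p * x))\<close>, so the derivative of
  \<open>F\<close> times the tail keeps the decaying factor
  \<open>exp (- \<eta> * \<alpha> * exp (p * x))\<close>; the resulting majorant has an explicit
  primitive.\<close>

lemma (in prob_space) nn_integral_exp_exp_finite:
  fixes X :: "'a \<Rightarrow> real"
  assumes X[measurable]: "X \<in> borel_measurable M" and pos: "\<alpha> > 0" "p > 0" "0 < \<theta>" "\<theta> < 1"
    and tail: "((\<lambda>x. ln (prob {\<omega>\<in>space M. X \<omega> > x}) / exp (p * x)) \<longlongrightarrow> - \<alpha>) at_top"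
  shows "(\<integral>\<^sup>+\<omega>. ennreal (exp (\<theta> * \<alpha> * exp (p * X \<omega>))) \<partial>M) < \<infinity>"
proof -
  define \<eta> where "\<eta> = (1 - \<theta>) / 2"
  have \<eta>: "\<eta> > 0" "\<theta> + \<eta> < 1" using pos by (auto simp: \<eta>_def field_simps)
  have "\<forall>\<^sub>F x in at_top. ln (prob {\<omega>\<in>space M. X \<omega> > x}) / exp (p * x) < - ((\<theta> + \<eta>) * \<alpha>)"
    using pos \<eta> by (intro order_tendstoD(2)[OF tail]) simp
  then obtain x0 where x0: "\<And>x. x \<ge> x0 \<Longrightarrow> ln (prob {\<omega>\<in>space M. X \<omega> > x}) / exp (p * x) < - ((\<theta> + \<eta>) * \<alpha>)"
    by (auto simp: eventually_at_top_linorder)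
  have T: "prob {\<omega>\<in>space M. X \<omega> > x} \<le> exp (- ((\<theta> + \<eta>) * \<alpha>) * exp (p * x))" if "x \<ge> x0" for x
  proof (cases "prob {\<omega>\<in>space M. X \<omega> > x} = 0")
    case False
    then have pp: "prob {\<omega>\<in>space M. X \<omega> > x} > 0" by (simp add: zero_less_measure_iff)
    have "ln (prob {\<omega>\<in>space M. X \<omega> > x}) < - ((\<theta> + \<eta>) * \<alpha>) * exp (p * x)"
      using x0[OF that] by (simp add: pos_divide_less_eq)
    then have "exp (ln (prob {\<omega>\<in>space M. X \<omega> > x})) \<le> exp (- ((\<theta> + \<eta>) * \<alpha>) * exp (p * x))"
      by simp
    then show ?thesis using pp by simp
  qed simp
  define F where "F x = exp (\<theta> * \<alpha> * exp (p * x))" for x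
  define f where "f x = \<theta> * \<alpha> * p * exp (p * x) * F x" for x
  have F: "DERIV F x :> f x" "0 \<le> f x" "0 \<le> F x" for x
    unfolding F_def f_def using pos by (auto intro!: derivative_eq_intros)
  have [measurable]: "f \<in> borel_measurable borel" "F \<in> borel_measurable borel"
    unfolding f_def F_def by measurable
  have mono: "F x \<le> F y" if "x \<le> y" for x y
    unfolding F_def using pos that by auto
  define I where "I \<omega> = (\<integral>\<^sup>+t. (ennreal (f t) * indicator {x0..} t) * indicator {..<X \<omega>} t \<partial>lborel)" for \<omega>
  have I[measurable]: "I \<in> borel_measurable M"
    unfolding I_def by (simp add: indicator_def of_bool_def, measurable)
  have "(\<integral>\<^sup>+\<omega>. ennreal (F (X \<omega>)) \<partial>M) \<le> (\<integral>\<^sup>+\<omega>. ennreal (F x0) + I \<omega> \<partial>M)"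
  proof (rule nn_integral_mono)
    fix \<omega>
    show "ennreal (F (X \<omega>)) \<le> ennreal (F x0) + I \<omega>"
    proof (cases "X \<omega> \<le> x0")
      case True
      then show ?thesis using mono[of "X \<omega>" x0] by (simp add: add_increasing2 ennreal_leI)
    next
      case False
      have "I \<omega> = (\<integral>\<^sup>+t. ennreal (f t) * indicator {x0..<X \<omega>} t \<partial>lborel)"
        unfolding I_def by (intro nn_integral_cong) (auto simp: indicator_def)
      also have "\<dots> = ennreal (F (X \<omega>) - F x0)"
        using False F by (intro nn_integral_FTC_Ico) auto
      finally show ?thesis using F(3) mono[of x0 "X \<omega>"] False by (simp flip: ennreal_plus)
    qed
  qed
  also have "\<dots> = ennreal (F x0) + (\<integral>\<^sup>+\<omega>. I \<omega> \<partial>M)"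
    by (subst nn_integral_add) (auto simp: emeasure_space_1)
  also have "(\<integral>\<^sup>+\<omega>. I \<omega> \<partial>M) = (\<integral>\<^sup>+t. (ennreal (f t) * indicator {x0..} t) * emeasure M {\<omega>\<in>space M. t < X \<omega>} \<partial>lborel)"
    unfolding I_def by (rule nn_integral_layer_cake) auto
  also have "\<dots> \<le> (\<integral>\<^sup>+t. ennreal (\<theta> * \<alpha> * p * exp (p * t) * exp (- (\<eta> * \<alpha> * exp (p * t)))) * indicator {x0..} t \<partial>lborel)"
  proof (rule nn_integral_mono)
    fix t :: real
    have "ennreal (f t) * emeasure M {\<omega>\<in>space M. t < X \<omega>} \<le> ennreal (\<theta> * \<alpha> * p * exp (p * t) * exp (- (\<eta> * \<alpha> * exp (p * t))))"
      if "t \<ge> x0"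
    proof -
      have "f t * prob {\<omega>\<in>space M. t < X \<omega>} \<le> f t * exp (- ((\<theta> + \<eta>) * \<alpha>) * exp (p * t))"
        using T[OF that] F(2) by (intro mult_left_mono) auto
      also have "\<dots> = \<theta> * \<alpha> * p * exp (p * t) * exp (- (\<eta> * \<alpha> * exp (p * t)))"
        by (simp add: f_def F_def algebra_simps flip: exp_add)
      finally show ?thesis
        using F(2)[of t] by (simp add: emeasure_eq_measure ennreal_leI flip: ennreal_mult)
    qed
    then show "(ennreal (f t) * indicator {x0..} t) * emeasure M {\<omega>\<in>space M. t < X \<omega>}
      \<le> ennreal (\<theta> * \<alpha> * p * exp (p * t) * exp (- (\<eta> * \<alpha> * exp (p * t)))) * indicator {x0..} t"
      by (auto simp: indicator_def)
  qed
  also have "\<dots> = ennreal (0 - (- (\<theta> / \<eta>) * exp (- (\<eta> * \<alpha> * exp (p * x0)))))"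
  proof (rule nn_integral_FTC_atLeast)
    show "((\<lambda>x. - (\<theta> / \<eta>) * exp (- (\<eta> * \<alpha> * exp (p * x)))) \<longlongrightarrow> 0) at_top"
      using pos \<eta> by real_asymp
    show "((\<lambda>x. - (\<theta> / \<eta>) * exp (- (\<eta> * \<alpha> * exp (p * x)))) has_real_derivative
        \<theta> * \<alpha> * p * exp (p * x) * exp (- (\<eta> * \<alpha> * exp (p * x)))) (at x)" for x
      using \<eta> by (auto intro!: derivative_eq_intros)
  qed (use pos in auto)
  finally have "(\<integral>\<^sup>+\<omega>. ennreal (F (X \<omega>)) \<partial>M) \<le> ennreal (F x0) + ennreal (0 - (- (\<theta> / \<eta>) * exp (- (\<eta> * \<alpha> * exp (p * x0)))))"
    by (simp add: add_left_mono)
  also have "\<dots> < \<infinity>" by (simp add: ennreal_add_less_top)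
  finally show ?thesis by (simp add: F_def)
qed

text \<open>On the event, \<open>K / p1 * exp (p1 * X1) + K / p2 * exp (p2 * X2)\<close> is at least \<open>\<beta> * exp l\<close> pointwise,
  and \<open>\<theta>\<close> times each summand has a finite exponential moment.\<close>
lemma (in prob_space) chernoff_sum_bound:
  fixes X1 X2 :: "'a \<Rightarrow> real"
  assumes ind: "indep_var borel X1 borel X2" and pos: "K > 0" "p1 > 0" "p2 > 0" "0 < \<theta>" "\<theta> < 1"
    and tail1: "((\<lambda>x. ln (prob {\<omega>\<in>space M. X1 \<omega> > x}) / exp (p1 * x)) \<longlongrightarrow> - (K / p1)) at_top"
    and tail2: "((\<lambda>x. ln (prob {\<omega>\<in>space M. X2 \<omega> > x}) / exp (p2 * x)) \<longlongrightarrow> - (K / p2)) at_top"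
    and W[measurable]: "W \<in> sets borel"
    and \<beta>: "\<And>x. x \<in> W \<Longrightarrow> \<beta> \<le> K / p1 * exp (- p1 * x) + K / p2 * exp (p2 * x)"
  obtains C where "C > 0" "\<And>l. prob {\<omega>\<in>space M. l / p1 + l / p2 < X1 \<omega> + X2 \<omega> \<and> X2 \<omega> - l / p2 \<in> W}
      \<le> C * exp (- \<theta> * \<beta> * exp l)"
proof -
  note [measurable] = indep_var_rv1[OF ind] indep_var_rv2[OF ind]
  define E1 E2 where "E1 = (\<integral>\<^sup>+\<omega>. ennreal (exp (\<theta> * (K / p1) * exp (p1 * X1 \<omega>))) \<partial>M)"
    and "E2 = (\<integral>\<^sup>+\<omega>. ennreal (exp (\<theta> * (K / p2) * exp (p2 * X2 \<omega>))) \<partial>M)"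
  have E: "E1 < \<infinity>" "E2 < \<infinity>"
    unfolding E1_def E2_def
    by (rule nn_integral_exp_exp_finite; use pos tail1 tail2 in simp)+
  have EE: "E1 * E2 < \<infinity>" using E by (simp add: ennreal_mult_less_top)
  \<comment> \<open>The \<open>+ 1\<close> makes \<open>C\<close> strictly positive, so that
    \<open>ln C\<close> can be used in the logarithmic estimate.\<close>
  define C where "C = enn2real (E1 * E2) + 1"
  show thesis
  proof (rule that)
    show "C > 0" by (simp add: C_def add_nonneg_pos)
    fix l :: real
    let ?S = "{\<omega>\<in>space M. l / p1 + l / p2 < X1 \<omega> + X2 \<omega> \<and> X2 \<omega> - l / p2 \<in> W}"
    let ?f = "\<lambda>z. ennreal (exp (\<theta> * (K / p1) * exp (p1 * fst z))) * ennreal (exp (\<theta> * (K / p2) * exp (p2 * snd z)))"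
    have "emeasure M ?S = (\<integral>\<^sup>+\<omega>. indicator ?S \<omega> \<partial>M)"
      by (rule nn_integral_indicator[symmetric]) measurable
    \<comment> \<open>Exponential Markov inequality: on the event the exponent on the right is
      nonnegative, off the event the indicator vanishes. Independence then factorizes the moment
      into \<open>E1 * E2\<close>, which does not involve \<open>l\<close>.\<close>
    also have "\<dots> \<le> (\<integral>\<^sup>+\<omega>. ennreal (exp (- \<theta> * \<beta> * exp l)) * ?f (X1 \<omega>, X2 \<omega>) \<partial>M)"
    proof (rule nn_integral_mono)
      fix \<omega>
      show "indicator ?S \<omega> \<le> ennreal (exp (- \<theta> * \<beta> * exp l)) * ?f (X1 \<omega>, X2 \<omega>)"
      proof (cases "\<omega> \<in> ?S")
        case True
        define x where "x = X2 \<omega> - l / p2"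
        have "X1 \<omega> \<ge> l / p1 - x" using True by (simp add: x_def)
        then have "l - p1 * x \<le> p1 * X1 \<omega>" using pos by (simp add: field_simps)
        then have "exp l * exp (- p1 * x) \<le> exp (p1 * X1 \<omega>)"
          by (simp flip: exp_add)
        then have 1: "K / p1 * (exp l * exp (- p1 * x)) \<le> K / p1 * exp (p1 * X1 \<omega>)"
          using pos by (intro mult_left_mono) auto
        have "exp (p2 * X2 \<omega>) = exp l * exp (p2 * x)"
          using pos by (simp add: x_def field_simps flip: exp_add)
        then have 2: "K / p2 * exp (p2 * X2 \<omega>) = K / p2 * (exp l * exp (p2 * x))" by simp
        have "\<beta> * exp l \<le> (K / p1 * exp (- p1 * x) + K / p2 * exp (p2 * x)) * exp l"
          using True by (intro mult_right_mono \<beta>) (auto simp: x_def)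
        also have "\<dots> = K / p1 * (exp l * exp (- p1 * x)) + K / p2 * (exp l * exp (p2 * x))"
          by (simp add: algebra_simps)
        also have "\<dots> \<le> K / p1 * exp (p1 * X1 \<omega>) + K / p2 * exp (p2 * X2 \<omega>)"
          using 1 2 by linarith
        finally have "\<theta> * (\<beta> * exp l) \<le> \<theta> * (K / p1 * exp (p1 * X1 \<omega>) + K / p2 * exp (p2 * X2 \<omega>))"
          using pos by (intro mult_left_mono) auto
        then have "1 \<le> exp (- \<theta> * \<beta> * exp l + (\<theta> * (K / p1) * exp (p1 * X1 \<omega>) + \<theta> * (K / p2) * exp (p2 * X2 \<omega>)))"
          by (simp add: algebra_simps)
        then have "1 \<le> exp (- \<theta> * \<beta> * exp l) * (exp (\<theta> * (K / p1) * exp (p1 * X1 \<omega>)) * exp (\<theta> * (K / p2) * exp (p2 * X2 \<omega>)))"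
          by (simp only: exp_add)
        then show ?thesis using True by (simp flip: ennreal_mult)
      qed simp
    qed
    also have "\<dots> = ennreal (exp (- \<theta> * \<beta> * exp l)) * (\<integral>\<^sup>+\<omega>. ?f (X1 \<omega>, X2 \<omega>) \<partial>M)"
      by (rule nn_integral_cmult) measurable
    also have "(\<integral>\<^sup>+\<omega>. ?f (X1 \<omega>, X2 \<omega>) \<partial>M) = E1 * E2"
      unfolding E1_def E2_def
      by (subst nn_integral_indep_var[OF ind]) (auto simp: nn_integral_cmult nn_integral_multc)
    also have "E1 * E2 \<le> ennreal C"
    proof -
      have "E1 * E2 = ennreal (enn2real (E1 * E2))" using EE by simp
      also have "\<dots> \<le> ennreal C" by (intro ennreal_leI) (simp add: C_def)
      finally show ?thesis .
    qed
    finally have "emeasure M ?S \<le> ennreal (exp (- \<theta> * \<beta> * exp l)) * ennreal C"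
      by (simp add: mult_left_mono)
    then show "prob ?S \<le> C * exp (- \<theta> * \<beta> * exp l)"
      using \<open>C > 0\<close> by (simp add: emeasure_eq_measure mult.commute flip: ennreal_mult)
  qed
qed

subsection \<open>Laplace's method\<close>

lemma exp_ge_quadratic:
  fixes y :: real
  assumes "y \<ge> 0"
  shows "y\<^sup>2 / 2 \<le> exp y - 1 - y"
  using exp_lower_Taylor_quadratic[OF assms] by simp

lemma exp_minus_one_minus_id_nonneg: "0 \<le> exp y - 1 - (y::real)"
  using exp_ge_add_one_self[of y] by linarith

text \<open>The bound \<open>y\<^sup>2 / 2 \<le> exp y - 1 - y\<close> holds only for
  \<open>y \<ge> 0\<close>. Of the two arguments \<open>- p1 * x\<close> and \<open>p2 * x\<close>
  one is always nonnegative, and the other bracket is dropped; \<open>min p1 p2\<close> covers both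
  signs. The estimate yields both the Gaussian majorant and the exponential gap outside a
  window.\<close>

lemma phase_quadratic_lower_bound:
  fixes K p1 p2 x :: real
  assumes pos: "K > 0" "p1 > 0" "p2 > 0"
  shows "K * min p1 p2 / 2 * x\<^sup>2
    \<le> K / p1 * (exp (- p1 * x) - 1 - (- p1 * x)) + K / p2 * (exp (p2 * x) - 1 - p2 * x)"
    (is "_ \<le> ?P + ?Q")
proof -
  have nn: "?P \<ge> 0" "?Q \<ge> 0"
    using pos by (intro mult_nonneg_nonneg exp_minus_one_minus_id_nonneg; simp)+
  show ?thesis
  proof (cases "x \<ge> 0")
    case True
    have "K * min p1 p2 / 2 * x\<^sup>2 \<le> K * p2 / 2 * x\<^sup>2"
      using pos by (intro mult_right_mono divide_right_mono mult_left_mono) auto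
    also have "\<dots> = K / p2 * ((p2 * x)\<^sup>2 / 2)"
      using pos by (simp add: power2_eq_square)
    also have "\<dots> \<le> ?Q"
      using pos True by (intro mult_left_mono exp_ge_quadratic) auto
    finally show ?thesis using nn by linarith
  next
    case False
    have "K * min p1 p2 / 2 * x\<^sup>2 \<le> K * p1 / 2 * x\<^sup>2"
      using pos by (intro mult_right_mono divide_right_mono mult_left_mono) auto
    also have "\<dots> = K / p1 * ((- p1 * x)\<^sup>2 / 2)"
      using pos by (simp add: power2_eq_square)
    also have "\<dots> \<le> ?P"
      using pos False by (intro mult_left_mono exp_ge_quadratic) (auto simp: mult_le_0_iff)
    finally show ?thesis using nn by linarith
  qed
qed

lemma has_bochner_integral_gaussian:
  fixes c :: real
  assumes c: "c > 0"
  shows "has_bochner_integral lborel (\<lambda>x. exp (- c * x\<^sup>2)) (sqrt (pi / c))"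
proof -
  define \<sigma> where "\<sigma> = sqrt (1 / (2 * c))"
  have \<sigma>: "\<sigma> > 0" "\<sigma>\<^sup>2 = 1 / (2 * c)" using c by (auto simp: \<sigma>_def)
  have "has_bochner_integral lborel (\<lambda>x. sqrt (pi / c) * normal_density 0 \<sigma> x) (sqrt (pi / c) * 1)"
    using integrable_normal_density[OF \<sigma>(1), of 0] integral_normal_density[OF \<sigma>(1), of 0]
    by (intro has_bochner_integral_mult_right) (simp add: has_bochner_integral_iff)
  moreover have "sqrt (pi / c) * normal_density 0 \<sigma> x = exp (- c * x\<^sup>2)" for x
    using c by (simp add: normal_density_def \<sigma>(2))
  ultimately show ?thesis by simp
qed

lemma scaled_exp_remainder_tendsto:
  fixes a :: real
  shows "((\<lambda>L. L * (exp (a * (w / sqrt L)) - 1 - a * (w / sqrt L))) \<longlongrightarrow> (a * w)\<^sup>2 / 2) at_top"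
proof -
  have "((\<lambda>L. L * (exp (b / sqrt L) - 1 - b / sqrt L)) \<longlongrightarrow> b\<^sup>2 / 2) at_top" for b :: real
  proof (cases b "0 :: real" rule: linorder_cases)
    case less
    then show ?thesis unfolding power2_eq_square by real_asymp
  next
    case greater
    then show ?thesis unfolding power2_eq_square by real_asymp
  qed simp
  from this[of "a * w"] show ?thesis by simp
qed

text \<open>Rescaling \<open>t = w / sqrt L\<close> turns \<open>L\<close> times the phase into
  \<open>c * w\<^sup>2\<close> in the limit, where \<open>2 * c = K * (p1 + p2)\<close> is the
  second derivative of the phase at 0, and sends \<open>exp (- p1 * t)\<close> to 1. Hence the limit
  is \<open>K * sqrt (pi / c)\<close>. The weight \<open>K * exp (- p1 * t)\<close> is what
  differentiating the model tail of \<open>X1\<close> produces.\<close>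

lemma laplace_two_exponentials:
  fixes K p1 p2 d :: real
  assumes pos: "K > 0" "p1 > 0" "p2 > 0" "d > 0"
  shows "((\<lambda>L. sqrt L * K * (LINT t|lborel. indicator {-d..d} t * (exp (- p1 * t) *
           exp (- L * (K / p1 * (exp (- p1 * t) - 1 - (- p1 * t)) + K / p2 * (exp (p2 * t) - 1 - p2 * t))))))
         \<longlongrightarrow> sqrt (2 * pi * K / (p1 + p2))) at_top"
proof -
  define h where "h t = K / p1 * (exp (- p1 * t) - 1 - (- p1 * t)) + K / p2 * (exp (p2 * t) - 1 - p2 * t)" for t
  define f where "f L t = (indicator {-d..d} t * (exp (- p1 * t) * exp (- L * h t)) :: real)" for L t
  have [measurable]: "h \<in> borel_measurable borel" unfolding h_def by measurable
  define c where "c = K * (p1 + p2) / 2"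
  have c: "c > 0" using pos by (simp add: c_def)
  have lim: "((\<lambda>L. LINT w|lborel. f L (w / sqrt L)) \<longlongrightarrow> (LINT w|lborel. exp (- c * w\<^sup>2))) at_top"
  proof (rule integral_dominated_convergence_at_top)
    show "integrable lborel (\<lambda>w. exp (p1 * d) * exp (- (K * min p1 p2 / 2) * w\<^sup>2))"
      using has_bochner_integral_gaussian[of "K * min p1 p2 / 2"] pos
      by (intro integrable_mult_right) (auto simp: has_bochner_integral_iff)
    \<comment> \<open>The constant \<open>exp (p1 * d)\<close> bounds the weight on the window, and
      the quadratic lower bound for the phase is invariant under the rescaling, which makes the
      majorant independent of \<open>L\<close>.\<close>
    show "\<forall>\<^sub>F L in at_top. AE w in lborel. norm (f L (w / sqrt L)) \<le> exp (p1 * d) * exp (- (K * min p1 p2 / 2) * w\<^sup>2)"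
      using eventually_gt_at_top[of "0::real"]
    proof eventually_elim
      case (elim L)
      have "norm (f L (w / sqrt L)) \<le> exp (p1 * d) * exp (- (K * min p1 p2 / 2) * w\<^sup>2)" for w
      proof (cases "w / sqrt L \<in> {-d..d}")
        case True
        have "K * min p1 p2 / 2 * w\<^sup>2 = L * (K * min p1 p2 / 2 * (w / sqrt L)\<^sup>2)"
          using elim by (simp add: power_divide)
        also have "\<dots> \<le> L * h (w / sqrt L)"
          unfolding h_def using elim pos by (intro mult_left_mono phase_quadratic_lower_bound) auto
        finally have "exp (- L * h (w / sqrt L)) \<le> exp (- (K * min p1 p2 / 2) * w\<^sup>2)" by simp
        moreover have "exp (- p1 * (w / sqrt L)) \<le> exp (p1 * d)"
        proof -
          have "p1 * (- (w / sqrt L)) \<le> p1 * d"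
            using True pos by (intro mult_left_mono) auto
          then show ?thesis by simp
        qed
        ultimately have "exp (- p1 * (w / sqrt L)) * exp (- L * h (w / sqrt L))
            \<le> exp (p1 * d) * exp (- (K * min p1 p2 / 2) * w\<^sup>2)"
          by (intro mult_mono) auto
        then show ?thesis using True by (simp add: f_def)
      qed (simp add: f_def)
      then show ?case by simp
    qed
    show "AE w in lborel. ((\<lambda>L. f L (w / sqrt L)) \<longlongrightarrow> exp (- c * w\<^sup>2)) at_top"
    proof (rule AE_I2)
      fix w :: real
      have w0: "((\<lambda>L. w / sqrt L) \<longlongrightarrow> 0) at_top"
        by (intro tendsto_divide_0[OF tendsto_const] filterlim_at_top_imp_at_infinity sqrt_at_top)
      have "((\<lambda>L. exp (- p1 * (w / sqrt L)) * exp (- (K / p1 * (L * (exp (- p1 * (w / sqrt L)) - 1 - (- p1 * (w / sqrt L))))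
            + K / p2 * (L * (exp (p2 * (w / sqrt L)) - 1 - p2 * (w / sqrt L))))))
          \<longlongrightarrow> exp (- p1 * 0) * exp (- (K / p1 * ((- p1 * w)\<^sup>2 / 2) + K / p2 * ((p2 * w)\<^sup>2 / 2)))) at_top"
        by (intro tendsto_intros w0 scaled_exp_remainder_tendsto)
      moreover have "exp (- p1 * 0) * exp (- (K / p1 * ((- p1 * w)\<^sup>2 / 2) + K / p2 * ((p2 * w)\<^sup>2 / 2))) = exp (- c * w\<^sup>2)"
        using pos by (simp add: c_def power2_eq_square field_simps)
      moreover have "\<forall>\<^sub>F L in at_top. exp (- p1 * (w / sqrt L)) * exp (- (K / p1 * (L * (exp (- p1 * (w / sqrt L)) - 1 - (- p1 * (w / sqrt L))))
            + K / p2 * (L * (exp (p2 * (w / sqrt L)) - 1 - p2 * (w / sqrt L))))) = f L (w / sqrt L)"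
        using tendstoD[OF w0 pos(4)]
      proof eventually_elim
        case (elim L)
        then have "w / sqrt L \<in> {-d..d}" unfolding dist_real_def atLeastAtMost_iff by linarith
        then have "f L (w / sqrt L) = exp (- p1 * (w / sqrt L)) * exp (- L * h (w / sqrt L))"
          by (simp add: f_def)
        moreover have "L * h (w / sqrt L) = K / p1 * (L * (exp (- p1 * (w / sqrt L)) - 1 - (- p1 * (w / sqrt L))))
            + K / p2 * (L * (exp (p2 * (w / sqrt L)) - 1 - p2 * (w / sqrt L)))"
          unfolding h_def by (simp only: distrib_left mult.left_commute)
        ultimately show ?case by simp
      qed
      ultimately show "((\<lambda>L. f L (w / sqrt L)) \<longlongrightarrow> exp (- c * w\<^sup>2)) at_top"
        using Lim_transform_eventually by fastforce
    qed
  qed (auto simp: f_def)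
  have "(LINT w|lborel. exp (- c * w\<^sup>2)) = sqrt (pi / c)"
    using has_bochner_integral_gaussian[OF c] by (simp add: has_bochner_integral_iff)
  moreover have "K * sqrt (pi / c) = sqrt (2 * pi * K / (p1 + p2))"
  proof -
    have "K * sqrt (pi / c) = sqrt (K\<^sup>2 * (pi / c))" using pos unfolding real_sqrt_mult by simp
    also have "K\<^sup>2 * (pi / c) = 2 * pi * K / (p1 + p2)"
      using pos by (simp add: c_def power2_eq_square)
    finally show ?thesis .
  qed
  ultimately have lim2: "((\<lambda>L. K * (LINT w|lborel. f L (w / sqrt L))) \<longlongrightarrow> sqrt (2 * pi * K / (p1 + p2))) at_top"
    using tendsto_mult_left[OF lim, of K] by simp
  have "\<forall>\<^sub>F L in at_top. K * (LINT w|lborel. f L (w / sqrt L)) = sqrt L * K * (LINT t|lborel. f L t)"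
    using eventually_gt_at_top[of "0::real"]
  proof eventually_elim
    case (elim L)
    have "(LINT t|lborel. f L t) = (1 / sqrt L) * (LINT w|lborel. f L (w / sqrt L))"
      using lborel_integral_real_affine[of "1 / sqrt L" "f L" 0] elim by simp
    then show ?case using elim by simp
  qed
  with lim2 show ?thesis
    unfolding f_def h_def by (rule Lim_transform_eventually)
qed

subsection \<open>Sums of variables with doubly exponential tails\<close>

lemma ln_tail_eventually_pos:
  fixes T :: "real \<Rightarrow> real"
  assumes "((\<lambda>x. ln (T x) / exp (p * x)) \<longlongrightarrow> - a) at_top" "a > 0" "\<And>x. T x \<ge> 0"
  shows "\<forall>\<^sub>F x in at_top. T x > 0"
proof -
  have "\<forall>\<^sub>F x in at_top. ln (T x) / exp (p * x) < 0"
    using assms(2) by (intro order_tendstoD[OF assms(1)]) simp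
  then show ?thesis
  proof eventually_elim
    case (elim x)
    \<comment> \<open>By convention \<open>ln 0 = 0\<close>, so a strictly negative ratio excludes
      \<open>T x = 0\<close>.\<close>
    then have "T x \<noteq> 0" by auto
    then show ?case using assms(3)[of x] by simp
  qed
qed

lemma filterlim_divide_at_top: "p > 0 \<Longrightarrow> filterlim (\<lambda>l::real. l / p) at_top at_top"
  by real_asymp

text \<open>The application takes \<open>X1 = ln Y1 + ln A\<close> and \<open>X2 = ln Y2 - ln A\<close>. The choice of \<open>A\<close> is what
  gives both tails the same constant, i.e. rates \<open>K / p1 * exp (p1 * x)\<close> and \<open>K / p2 * exp (p2 * x)\<close>,
  so that the saddle point sits at \<open>X2 = l / p2\<close>. The variable \<open>l\<close> is the logarithm of the large parameter
  \<open>u powr (p1 * p2 / (p1 + p2))\<close>.\<close>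
locale exp_tail_pair = prob_space +
  fixes X1 X2 :: "'a \<Rightarrow> real" and K p1 p2 :: real
  assumes ind: "indep_var borel X1 borel X2"
    and pos: "K > 0" "p1 > 0" "p2 > 0"
begin

definition "T1 x = prob {\<omega>\<in>space M. x < X1 \<omega>}"
definition "T2 x = prob {\<omega>\<in>space M. x < X2 \<omega>}"
definition "S l = prob {\<omega>\<in>space M. l / p1 + l / p2 < X1 \<omega> + X2 \<omega>}"
definition "B = K / p1 + K / p2"

text \<open>The half-open interval matches integration by parts: its boundary terms are then strict
  tails \<open>P(X > a)\<close> and \<open>P(X > b)\<close>.\<close>

definition "window d l =
  prob {\<omega>\<in>space M. l / p1 + l / p2 < X1 \<omega> + X2 \<omega> \<and> X2 \<omega> - l / p2 \<in> {-d<..d}}"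

text \<open>The phase minus its minimum \<open>B\<close>. The linear terms inserted here cancel
  because both rates share the constant \<open>K\<close>; with them each summand is nonnegative by
  itself.\<close>

definition "excess t = K / p1 * (exp (- p1 * t) - 1 - (- p1 * t)) + K / p2 * (exp (p2 * t) - 1 - p2 * t)"

definition "laplace d L = (LINT t|lborel. indicator {-d..d} t * (exp (- p1 * t) * exp (- L * excess t)))"

lemma X_measurable[measurable]: "X1 \<in> borel_measurable M" "X2 \<in> borel_measurable M"
  using indep_var_rv1[OF ind] indep_var_rv2[OF ind] by auto

lemma B_pos: "B > 0"
  using pos by (simp add: B_def add_pos_pos)

lemma phase_eq: "K / p1 * exp (- p1 * t) + K / p2 * exp (p2 * t) = B + excess t"
  using pos by (simp add: B_def excess_def field_simps)

lemma excess_ge: "K * min p1 p2 / 2 * t\<^sup>2 \<le> excess t"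
  unfolding excess_def by (rule phase_quadratic_lower_bound[OF pos])

lemma excess_nonneg: "0 \<le> excess t"
  by (rule order_trans[OF _ excess_ge]) (use pos in simp)

section \<open>Logarithmic asymptotics of the sum\<close>

lemma T1_T2_le_S: "T1 (l / p1) * T2 (l / p2) \<le> S l"
proof -
  have "T1 (l / p1) * T2 (l / p2)
      = prob ((\<lambda>\<omega>. (X1 \<omega>, X2 \<omega>)) -` ({l / p1<..} \<times> {l / p2<..}) \<inter> space M)"
    using indep_varD[OF ind, of "{l / p1<..}" "{l / p2<..}"]
    by (simp add: T1_def T2_def vimage_def Int_def conj_commute)
  also have "\<dots> \<le> S l"
    unfolding S_def by (intro finite_measure_mono) (auto simp: add_strict_mono)
  finally show ?thesis .
qed

context
  assumes tail1: "((\<lambda>x. ln (T1 x) / exp (p1 * x)) \<longlongrightarrow> - (K / p1)) at_top"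
    and tail2: "((\<lambda>x. ln (T2 x) / exp (p2 * x)) \<longlongrightarrow> - (K / p2)) at_top"
begin

lemma chernoff:
  assumes "0 < \<theta>" "\<theta> < 1" "W \<in> sets borel" "\<And>x. x \<in> W \<Longrightarrow> \<beta> \<le> B + excess x"
  obtains C where "C > 0" "\<And>l. prob {\<omega>\<in>space M. l / p1 + l / p2 < X1 \<omega> + X2 \<omega> \<and> X2 \<omega> - l / p2 \<in> W}
      \<le> C * exp (- \<theta> * \<beta> * exp l)"
  using chernoff_sum_bound[OF ind pos assms(1,2) tail1[unfolded T1_def] tail2[unfolded T2_def] assms(3)]
    assms(4) unfolding phase_eq by blast

lemma log_tail_sum: "((\<lambda>l. ln (S l) / exp l) \<longlongrightarrow> - B) at_top"
proof (rule order_tendstoI)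
  note lim = filterlim_divide_at_top[OF pos(2)] filterlim_divide_at_top[OF pos(3)]
  have l1: "((\<lambda>l. ln (T1 (l / p1)) / exp l) \<longlongrightarrow> - (K / p1)) at_top"
    using filterlim_compose[OF tail1 lim(1)] pos by simp
  have l2: "((\<lambda>l. ln (T2 (l / p2)) / exp l) \<longlongrightarrow> - (K / p2)) at_top"
    using filterlim_compose[OF tail2 lim(2)] pos by simp
  have "\<forall>\<^sub>F x in at_top. T1 x > 0" "\<forall>\<^sub>F x in at_top. T2 x > 0"
    using pos by (intro ln_tail_eventually_pos[OF tail1] ln_tail_eventually_pos[OF tail2];
      simp add: T1_def T2_def)+
  note ev = eventually_compose_filterlim[OF this(1) lim(1)] eventually_compose_filterlim[OF this(2) lim(2)]
  {
    fix y assume "y < - B"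
    have "((\<lambda>l. ln (T1 (l / p1)) / exp l + ln (T2 (l / p2)) / exp l) \<longlongrightarrow> - B) at_top"
      using tendsto_add[OF l1 l2] by (simp add: B_def)
    from order_tendstoD(1)[OF this \<open>y < - B\<close>] ev
    show "\<forall>\<^sub>F l in at_top. y < ln (S l) / exp l"
    proof eventually_elim
      case (elim l)
      have "ln (T1 (l / p1)) + ln (T2 (l / p2)) = ln (T1 (l / p1) * T2 (l / p2))"
        using elim by (simp add: ln_mult)
      also have "\<dots> \<le> ln (S l)"
        using elim T1_T2_le_S[of l] by (intro ln_mono) (auto intro: mult_pos_pos)
      finally have "(ln (T1 (l / p1)) + ln (T2 (l / p2))) / exp l \<le> ln (S l) / exp l"
        by (simp add: divide_right_mono)
      then show ?case using elim(1) by (simp add: add_divide_distrib)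
    qed
  }
  {
    fix y assume y: "- B < y"
    \<comment> \<open>The second entry is chosen so that
      \<open>- \<theta> * B \<le> (y - B) / 2\<close>, which is below \<open>y\<close> because
      \<open>- B < y\<close>. The entry 1 / 2 keeps \<theta> positive when \<open>y\<close> is
      large.\<close>
    define \<theta> where "\<theta> = max (1 / 2) (1 - (y + B) / (2 * B))"
    have \<theta>: "0 < \<theta>" "\<theta> < 1" using y B_pos by (auto simp: \<theta>_def)
    have "(1 - (y + B) / (2 * B)) * B \<le> \<theta> * B"
      using B_pos by (intro mult_right_mono) (auto simp: \<theta>_def)
    moreover have "(1 - (y + B) / (2 * B)) * B = (B - y) / 2"
      using B_pos by (simp add: field_simps)
    ultimately have \<theta>B: "- \<theta> * B < y" using y by simp
    obtain C where C: "C > 0" "\<And>l. prob {\<omega>\<in>space M. l / p1 + l / p2 < X1 \<omega> + X2 \<omega> \<and> X2 \<omega> - l / p2 \<in> UNIV}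
      \<le> C * exp (- \<theta> * B * exp l)"
      using chernoff[OF \<theta>, of UNIV B] excess_nonneg by auto
    have "((\<lambda>l. ln C / exp l + - \<theta> * B) \<longlongrightarrow> - \<theta> * B) at_top"
      by real_asymp
    from order_tendstoD(2)[OF this \<theta>B] ev
    show "\<forall>\<^sub>F l in at_top. ln (S l) / exp l < y"
    proof eventually_elim
      case (elim l)
      have "0 < S l" using elim T1_T2_le_S[of l] by (meson less_le_trans mult_pos_pos)
      then have "ln (S l) \<le> ln (C * exp (- \<theta> * B * exp l))"
        using C(2)[of l] by (intro ln_mono) (auto simp: S_def)
      also have "\<dots> = ln C + - \<theta> * B * exp l"
        using C(1) by (simp add: ln_mult)
      finally have "ln (S l) / exp l \<le> (ln C + - \<theta> * B * exp l) / exp l"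
        by (simp add: divide_right_mono)
      then show ?case using elim(1) by (simp add: diff_divide_distrib add_divide_distrib)
    qed
  }
qed

end

section \<open>The window around the saddle point\<close>

lemma nn_integral_laplace:
  assumes "H \<ge> 0"
  shows "(\<integral>\<^sup>+t. ennreal (exp l * K * exp (- p1 * t) * exp (- exp l * (K / p1 * exp (- p1 * t)))) * indicator {-d..d} t *
           ennreal (H * exp (- exp l * (K / p2 * exp (p2 * t)))) \<partial>lborel)
         = ennreal (H * exp l * K * exp (- B * exp l) * laplace d (exp l))"
proof -
  let ?g = "\<lambda>t. indicator {-d..d} t * (exp (- p1 * t) * exp (- exp l * excess t))"
  have "continuous_on {-d..d} (\<lambda>t. exp (- p1 * t) * exp (- exp l * excess t))"
    unfolding excess_def using pos by (intro continuous_intros) auto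
  then have int: "integrable lborel ?g"
    using borel_integrable_compact[of "{-d..d}" "\<lambda>t. exp (- p1 * t) * exp (- exp l * excess t)"] by simp
  have "(\<integral>\<^sup>+t. ennreal (exp l * K * exp (- p1 * t) * exp (- exp l * (K / p1 * exp (- p1 * t)))) * indicator {-d..d} t *
           ennreal (H * exp (- exp l * (K / p2 * exp (p2 * t)))) \<partial>lborel)
      = (\<integral>\<^sup>+t. ennreal (H * exp l * K * exp (- B * exp l) * ?g t) \<partial>lborel)"
  proof (rule nn_integral_cong)
    fix t :: real
    \<comment> \<open>The integrand is the derivative of the model tail of \<open>X1\<close> times
      the model tail of \<open>X2\<close>. Their exponents add up to the phase, from which the
      constant \<open>B\<close> is factored out.\<close>
    have "exp (- exp l * (K / p1 * exp (- p1 * t))) * exp (- exp l * (K / p2 * exp (p2 * t)))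
        = exp (- exp l * (K / p1 * exp (- p1 * t) + K / p2 * exp (p2 * t)))"
      by (simp add: distrib_left flip: exp_add)
    also have "\<dots> = exp (- B * exp l) * exp (- exp l * excess t)"
      unfolding phase_eq by (simp add: algebra_simps flip: exp_add)
    finally have *: "exp (- exp l * (K / p1 * exp (- p1 * t))) * exp (- exp l * (K / p2 * exp (p2 * t)))
      = exp (- B * exp l) * exp (- exp l * excess t)" .
    have "exp l * K * exp (- p1 * t) * exp (- exp l * (K / p1 * exp (- p1 * t))) * (H * exp (- exp l * (K / p2 * exp (p2 * t))))
      = H * exp l * K * exp (- p1 * t) * (exp (- exp l * (K / p1 * exp (- p1 * t))) * exp (- exp l * (K / p2 * exp (p2 * t))))"
      by (simp only: mult_ac)
    also have "\<dots> = H * exp l * K * exp (- B * exp l) * (exp (- p1 * t) * exp (- exp l * excess t))"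
      unfolding * by (simp only: mult_ac)
    finally have **: "exp l * K * exp (- p1 * t) * exp (- exp l * (K / p1 * exp (- p1 * t))) * (H * exp (- exp l * (K / p2 * exp (p2 * t))))
      = H * exp l * K * exp (- B * exp l) * (exp (- p1 * t) * exp (- exp l * excess t))" .
    show "ennreal (exp l * K * exp (- p1 * t) * exp (- exp l * (K / p1 * exp (- p1 * t)))) * indicator {-d..d} t *
           ennreal (H * exp (- exp l * (K / p2 * exp (p2 * t)))) = ennreal (H * exp l * K * exp (- B * exp l) * ?g t)"
    proof (cases "t \<in> {-d..d}")
      case True
      then have i: "indicator {-d..d} t = (1 :: ennreal)" "indicator {-d..d} t = (1 :: real)" by auto
      show ?thesis
        unfolding i mult_1_right mult_1_left **[symmetric]
        using pos assms by (intro ennreal_mult[symmetric]) auto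
    qed simp
  qed
  also have "\<dots> = ennreal (LINT t|lborel. H * exp l * K * exp (- B * exp l) * ?g t)"
    using pos assms by (intro nn_integral_eq_integral integrable_mult_right int AE_I2) auto
  also have "(LINT t|lborel. H * exp l * K * exp (- B * exp l) * ?g t) = H * exp l * K * exp (- B * exp l) * laplace d (exp l)"
    unfolding laplace_def by (rule integral_mult_right_zero)
  finally show ?thesis .
qed

lemma laplace_nonneg: "laplace d L \<ge> 0"
  unfolding laplace_def by (intro integral_nonneg_AE AE_I2) auto

text \<open>Conditioning on \<open>X2\<close>, by independence, leaves the tail of \<open>X1\<close>
  at a point that depends on \<open>X2\<close>; this is the form in which that tail can be replaced
  by its model.\<close>

lemma emeasure_window:
  "ennreal (window d l) = (\<integral>\<^sup>+\<omega>. ennreal (T1 (l / p1 - (X2 \<omega> - l / p2))) * indicator {-d<..d} (X2 \<omega> - l / p2) \<partial>M)"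
proof -
  let ?A = "{z :: real \<times> real. l / p1 + l / p2 < fst z + snd z \<and> snd z - l / p2 \<in> {-d<..d}}"
  have "{z \<in> space (borel \<Otimes>\<^sub>M borel). l / p1 + l / p2 < fst z + snd z \<and> snd z - l / p2 \<in> {-d<..d}}
      \<in> sets (borel \<Otimes>\<^sub>M borel)"
    by measurable
  then have A: "?A \<in> sets (borel \<Otimes>\<^sub>M borel)" by (simp add: space_pair_measure)
  have "ennreal (window d l) = (\<integral>\<^sup>+\<omega>. indicator ?A (X1 \<omega>, X2 \<omega>) \<partial>M)"
  proof -
    let ?S = "{\<omega>\<in>space M. l / p1 + l / p2 < X1 \<omega> + X2 \<omega> \<and> X2 \<omega> - l / p2 \<in> {-d<..d}}"
    have "ennreal (window d l) = (\<integral>\<^sup>+\<omega>. indicator ?S \<omega> \<partial>M)"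
      unfolding window_def emeasure_eq_measure[symmetric]
      by (rule nn_integral_indicator[symmetric]) measurable
    also have "\<dots> = (\<integral>\<^sup>+\<omega>. indicator ?A (X1 \<omega>, X2 \<omega>) \<partial>M)"
      by (rule nn_integral_cong) (auto simp: indicator_def)
    finally show ?thesis .
  qed
  also have "\<dots> = (\<integral>\<^sup>+\<omega>'. \<integral>\<^sup>+\<omega>. indicator ?A (X1 \<omega>, X2 \<omega>') \<partial>M \<partial>M)"
    by (rule nn_integral_indep_var[OF ind]) (use A in simp)
  also have "\<dots> = (\<integral>\<^sup>+\<omega>'. ennreal (T1 (l / p1 - (X2 \<omega>' - l / p2))) * indicator {-d<..d} (X2 \<omega>' - l / p2) \<partial>M)"
  proof (rule nn_integral_cong)
    fix \<omega>'
    have "(\<integral>\<^sup>+\<omega>. indicator ?A (X1 \<omega>, X2 \<omega>') \<partial>M)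
        = (\<integral>\<^sup>+\<omega>. indicator {-d<..d} (X2 \<omega>' - l / p2) * indicator {\<omega>\<in>space M. l / p1 - (X2 \<omega>' - l / p2) < X1 \<omega>} \<omega> \<partial>M)"
      by (rule nn_integral_cong) (auto simp: indicator_def)
    then show "(\<integral>\<^sup>+\<omega>. indicator ?A (X1 \<omega>, X2 \<omega>') \<partial>M)
        = ennreal (T1 (l / p1 - (X2 \<omega>' - l / p2))) * indicator {-d<..d} (X2 \<omega>' - l / p2)"
      by (simp add: nn_integral_cmult_indicator T1_def emeasure_eq_measure mult.commute)
  qed
  finally show ?thesis .
qed

text \<open>Up to the factor \<open>G\<close>, the tail of \<open>X1\<close> is the smooth
  \<open>F\<close>, so the window is compared with \<open>G * J\<close>, and integration by parts
  trades \<open>J\<close> for the integral \<open>N\<close> of the tail of \<open>X2\<close>. The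
  upper bound retains the edge term at \<open>- d\<close>, the lower bound the one at
  \<open>d\<close>. The latter is subtracted and so needs an upper bound on \<open>T2\<close>, hence
  the separate constant \<open>H'\<close>.\<close>

lemma
  fixes d l :: real
  assumes d: "d > 0" and GH: "G \<ge> 0" "H \<ge> 0" "H' \<ge> 0"
  shows window_upper: "\<lbrakk>\<And>t. \<bar>t\<bar> \<le> d \<Longrightarrow> T1 (l / p1 - t) \<le> G * exp (- exp l * (K / p1 * exp (- p1 * t)));
           \<And>t. \<bar>t\<bar> \<le> d \<Longrightarrow> T2 (l / p2 + t) \<le> H * exp (- exp l * (K / p2 * exp (p2 * t)))\<rbrakk> \<Longrightarrow>
         window d l \<le> G * (H * exp (- exp l * (B + excess (- d))) + H * exp l * K * exp (- B * exp l) * laplace d (exp l))"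
    and window_lower: "\<lbrakk>\<And>t. \<bar>t\<bar> \<le> d \<Longrightarrow> G * exp (- exp l * (K / p1 * exp (- p1 * t))) \<le> T1 (l / p1 - t);
           \<And>t. \<bar>t\<bar> \<le> d \<Longrightarrow> H * exp (- exp l * (K / p2 * exp (p2 * t))) \<le> T2 (l / p2 + t);
           T2 (l / p2 + d) \<le> H' * exp (- exp l * (K / p2 * exp (p2 * d)))\<rbrakk> \<Longrightarrow>
         G * (H * exp l * K * exp (- B * exp l) * laplace d (exp l) - H' * exp (- exp l * (B + excess d))) \<le> window d l"
proof -
  define X where "X \<omega> = X2 \<omega> - l / p2" for \<omega>
  have X[measurable]: "X \<in> borel_measurable M" unfolding X_def by measurable
  define F where "F t = exp (- exp l * (K / p1 * exp (- p1 * t)))" for t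
  define f where "f t = exp l * K * exp (- p1 * t) * exp (- exp l * (K / p1 * exp (- p1 * t)))" for t
  have [measurable]: "f \<in> borel_measurable borel" "F \<in> borel_measurable borel"
    unfolding f_def F_def by measurable
  have F: "DERIV F t :> f t" "0 \<le> f t" "0 \<le> F t" for t
    unfolding F_def f_def using pos by (auto intro!: derivative_eq_intros)
  define J where "J = (\<integral>\<^sup>+\<omega>. ennreal (F (X \<omega>)) * indicator {-d<..d} (X \<omega>) \<partial>M)"
  define N where "N = (\<integral>\<^sup>+t. ennreal (f t) * indicator {-d..d} t * emeasure M {\<omega>\<in>space M. t < X \<omega>} \<partial>lborel)"
  have em: "emeasure M {\<omega>\<in>space M. t < X \<omega>} = ennreal (T2 (l / p2 + t))" for t
    unfolding T2_def emeasure_eq_measure[symmetric] X_def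
    by (intro arg_cong[of _ _ "emeasure M"]) auto
  have JN: "J \<le> ennreal (F (- d)) * ennreal (T2 (l / p2 + (- d))) + N"
      "N \<le> J + ennreal (F d) * ennreal (T2 (l / p2 + d))"
    using integration_by_parts_window[OF X, of f F "-d" d] F d
    unfolding J_def N_def em by auto
  have Fexp: "F t * exp (- exp l * (K / p2 * exp (p2 * t))) = exp (- exp l * (B + excess t))" for t
    unfolding F_def phase_eq[symmetric] by (simp add: algebra_simps flip: exp_add)
  have Fmult: "ennreal (F t) * ennreal (h * exp (- exp l * (K / p2 * exp (p2 * t)))) = ennreal (h * exp (- exp l * (B + excess t)))"
    if "h \<ge> 0" for h t
    unfolding Fexp[symmetric] mult.left_commute[of h]
    using F(3) that by (intro ennreal_mult[symmetric]) auto
  {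
    assume u1: "\<And>t. \<bar>t\<bar> \<le> d \<Longrightarrow> T1 (l / p1 - t) \<le> G * exp (- exp l * (K / p1 * exp (- p1 * t)))"
      and u2: "\<And>t. \<bar>t\<bar> \<le> d \<Longrightarrow> T2 (l / p2 + t) \<le> H * exp (- exp l * (K / p2 * exp (p2 * t)))"
    have "ennreal (window d l) \<le> (\<integral>\<^sup>+\<omega>. ennreal G * (ennreal (F (X \<omega>)) * indicator {-d<..d} (X \<omega>)) \<partial>M)"
      unfolding emeasure_window X_def[symmetric]
      using u1 GH by (intro nn_integral_mono) (auto simp: indicator_def F_def intro!: ennreal_leI simp flip: ennreal_mult)
    also have "\<dots> = ennreal G * J" unfolding J_def by (rule nn_integral_cmult) measurable
    also have "\<dots> \<le> ennreal G * (ennreal (H * exp (- exp l * (B + excess (- d)))) + ennreal (H * exp l * K * exp (- B * exp l) * laplace d (exp l)))"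
    proof (intro mult_left_mono)
      have "ennreal (F (- d)) * ennreal (T2 (l / p2 + (- d))) \<le> ennreal (F (- d)) * ennreal (H * exp (- exp l * (K / p2 * exp (p2 * (- d)))))"
        using u2[of "- d"] d by (intro mult_left_mono ennreal_leI) auto
      also have "\<dots> = ennreal (H * exp (- exp l * (B + excess (- d))))"
        by (rule Fmult[OF GH(2)])
      finally have 1: "ennreal (F (- d)) * ennreal (T2 (l / p2 + (- d))) \<le> ennreal (H * exp (- exp l * (B + excess (- d))))" .
      have "N \<le> (\<integral>\<^sup>+t. ennreal (f t) * indicator {-d..d} t * ennreal (H * exp (- exp l * (K / p2 * exp (p2 * t)))) \<partial>lborel)"
        unfolding N_def em
        using u2 by (intro nn_integral_mono) (auto simp: indicator_def intro!: mult_left_mono ennreal_leI)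
      also have "\<dots> = ennreal (H * exp l * K * exp (- B * exp l) * laplace d (exp l))"
        unfolding f_def using GH by (rule_tac nn_integral_laplace) simp
      finally show "J \<le> ennreal (H * exp (- exp l * (B + excess (- d)))) + ennreal (H * exp l * K * exp (- B * exp l) * laplace d (exp l))"
        using JN(1) 1 by (meson add_mono order_trans)
    qed simp
    also have "\<dots> = ennreal (G * (H * exp (- exp l * (B + excess (- d))) + H * exp l * K * exp (- B * exp l) * laplace d (exp l)))"
    proof -
      have a: "0 \<le> H * exp (- exp l * (B + excess (- d)))"
          "0 \<le> H * exp l * K * exp (- B * exp l) * laplace d (exp l)"
        using GH pos laplace_nonneg by auto
      show ?thesis
        by (simp only: ennreal_plus[OF a] ennreal_mult[OF GH(1) add_nonneg_nonneg[OF a]])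
    qed
    finally show "window d l \<le> G * (H * exp (- exp l * (B + excess (- d))) + H * exp l * K * exp (- B * exp l) * laplace d (exp l))"
      using GH pos laplace_nonneg by (subst (asm) ennreal_le_iff) auto
  }
  {
    assume l1: "\<And>t. \<bar>t\<bar> \<le> d \<Longrightarrow> G * exp (- exp l * (K / p1 * exp (- p1 * t))) \<le> T1 (l / p1 - t)"
      and l2: "\<And>t. \<bar>t\<bar> \<le> d \<Longrightarrow> H * exp (- exp l * (K / p2 * exp (p2 * t))) \<le> T2 (l / p2 + t)"
      and l3: "T2 (l / p2 + d) \<le> H' * exp (- exp l * (K / p2 * exp (p2 * d)))"
    have "ennreal (H * exp l * K * exp (- B * exp l) * laplace d (exp l))
        = (\<integral>\<^sup>+t. ennreal (f t) * indicator {-d..d} t * ennreal (H * exp (- exp l * (K / p2 * exp (p2 * t)))) \<partial>lborel)"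
      unfolding f_def using GH by (rule_tac nn_integral_laplace[symmetric]) simp
    also have "\<dots> \<le> N"
      unfolding N_def em
      using l2 by (intro nn_integral_mono) (auto simp: indicator_def intro!: mult_left_mono ennreal_leI)
    also have "\<dots> \<le> J + ennreal (F d) * ennreal (T2 (l / p2 + d))" by (rule JN)
    also have "\<dots> \<le> J + ennreal (F d) * ennreal (H' * exp (- exp l * (K / p2 * exp (p2 * d))))"
      using l3 by (intro add_left_mono mult_left_mono ennreal_leI) auto
    also have "ennreal (F d) * ennreal (H' * exp (- exp l * (K / p2 * exp (p2 * d)))) = ennreal (H' * exp (- exp l * (B + excess d)))"
      by (rule Fmult[OF GH(3)])
    finally have "ennreal G * ennreal (H * exp l * K * exp (- B * exp l) * laplace d (exp l))
        \<le> ennreal G * (J + ennreal (H' * exp (- exp l * (B + excess d))))"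
      by (rule mult_left_mono) simp
    also have "\<dots> = ennreal G * J + ennreal (G * (H' * exp (- exp l * (B + excess d))))"
      using GH by (simp add: distrib_left flip: ennreal_mult)
    also have "ennreal G * J = (\<integral>\<^sup>+\<omega>. ennreal G * (ennreal (F (X \<omega>)) * indicator {-d<..d} (X \<omega>)) \<partial>M)"
      unfolding J_def by (rule nn_integral_cmult[symmetric]) measurable
    also have "\<dots> \<le> ennreal (window d l)"
      unfolding emeasure_window X_def[symmetric]
      using l1 GH by (intro nn_integral_mono) (auto simp: indicator_def F_def intro!: ennreal_leI simp flip: ennreal_mult)
    finally have "ennreal (G * (H * exp l * K * exp (- B * exp l) * laplace d (exp l)))
        \<le> ennreal (window d l + G * (H' * exp (- exp l * (B + excess d))))"
      using GH pos laplace_nonneg by (simp add: ennreal_mult ennreal_plus add_right_mono window_def)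
    then have "G * (H * exp l * K * exp (- B * exp l) * laplace d (exp l))
        \<le> window d l + G * (H' * exp (- exp l * (B + excess d)))"
      using GH by (subst (asm) ennreal_le_iff) (auto simp: window_def)
    then show "G * (H * exp l * K * exp (- B * exp l) * laplace d (exp l) - H' * exp (- exp l * (B + excess d))) \<le> window d l"
      by (simp add: right_diff_distrib)
  }
qed

end

section \<open>Tail estimates from asymptotic equivalence\<close>

lemma local_tail_bounds:
  fixes T G :: "real \<Rightarrow> real"
  assumes T: "T \<sim>[at_top] (\<lambda>x. G x * exp (- (a * exp (p * x))))" and G: "\<forall>\<^sub>F x in at_top. G x > 0"
    and loc: "\<And>e. e > 0 \<Longrightarrow> \<exists>d>0. \<forall>\<^sub>F x in at_top. \<forall>t. \<bar>t\<bar> \<le> d \<longrightarrow> \<bar>ln (G (x + t)) - ln (G x)\<bar> \<le> e"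
    and e: "e > 0"
  shows "\<exists>d>0. \<forall>\<^sub>F x in at_top. \<forall>t. \<bar>t\<bar> \<le> d \<longrightarrow>
      exp (- e) * G x * exp (- (a * exp (p * (x + t)))) \<le> T (x + t) \<and>
      T (x + t) \<le> exp e * G x * exp (- (a * exp (p * (x + t))))"
proof -
  define U where "U x = G x * exp (- (a * exp (p * x)))" for x
  have "((\<lambda>x. T x / U x) \<longlongrightarrow> 1) at_top"
    unfolding U_def by (intro asymp_equivD_strong[OF T] eventually_mono[OF G]) simp
  then have "\<forall>\<^sub>F x in at_top. exp (- e / 2) < T x / U x" "\<forall>\<^sub>F x in at_top. T x / U x < exp (e / 2)"
    using e by (auto intro: order_tendstoD)
  then have "\<forall>\<^sub>F x in at_top. exp (- e / 2) * U x \<le> T x \<and> T x \<le> exp (e / 2) * U x \<and> G x > 0"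
    using G
  proof eventually_elim
    case (elim x)
    then have "U x > 0" by (simp add: U_def)
    then show ?case using elim by (simp add: field_simps)
  qed
  then obtain x0 where x0: "\<And>x. x \<ge> x0 \<Longrightarrow> exp (- e / 2) * U x \<le> T x \<and> T x \<le> exp (e / 2) * U x \<and> G x > 0"
    by (auto simp: eventually_at_top_linorder)
  \<comment> \<open>One half of \<open>e\<close> pays for freezing \<open>G\<close> at
    \<open>x\<close>, the other for the asymptotic equivalence at \<open>x + t\<close>. The double
    exponential is kept at \<open>x + t\<close>, being far too sensitive to be frozen.\<close>
  obtain d where d: "d > 0" "\<forall>\<^sub>F x in at_top. \<forall>t. \<bar>t\<bar> \<le> d \<longrightarrow> \<bar>ln (G (x + t)) - ln (G x)\<bar> \<le> e / 2"
    using loc[of "e / 2"] e by auto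
  have "\<forall>\<^sub>F x in at_top. \<forall>t. \<bar>t\<bar> \<le> d \<longrightarrow>
      exp (- e) * G x * exp (- (a * exp (p * (x + t)))) \<le> T (x + t) \<and>
      T (x + t) \<le> exp e * G x * exp (- (a * exp (p * (x + t))))"
    using d(2) eventually_ge_at_top[of "x0 + d"]
  proof eventually_elim
    case (elim x)
    show ?case
    proof (intro allI impI)
      fix t assume t: "\<bar>t\<bar> \<le> d"
      define E where "E = exp (- (a * exp (p * (x + t))))"
      have "x + t \<ge> x0" "x \<ge> x0" using t elim(2) d(1) by auto
      note 1 = x0[OF this(1)] and 2 = x0[OF this(2)]
      have gp: "G (x + t) > 0" "G x > 0" using 1 2 by auto
      have l: "\<bar>ln (G (x + t)) - ln (G x)\<bar> \<le> e / 2" using elim(1) t by blast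
      have "exp (ln (G (x + t))) \<le> exp (e / 2 + ln (G x))"
        using l by (subst exp_le_cancel_iff) linarith
      then have u: "G (x + t) \<le> exp (e / 2) * G x" by (simp only: exp_add exp_ln[OF gp(1)] exp_ln[OF gp(2)])
      have "exp (- e / 2 + ln (G x)) \<le> exp (ln (G (x + t)))"
        using l by (subst exp_le_cancel_iff) linarith
      then have o: "exp (- e / 2) * G x \<le> G (x + t)" by (simp only: exp_add exp_ln[OF gp(1)] exp_ln[OF gp(2)])
      have "T (x + t) \<le> exp (e / 2) * (G (x + t) * E)" using 1 by (simp add: U_def E_def)
      also have "\<dots> \<le> exp (e / 2) * (exp (e / 2) * G x * E)"
        using u by (intro mult_left_mono mult_right_mono) (auto simp: E_def)
      also have "\<dots> = exp e * G x * E" by (simp flip: exp_add)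
      finally have ub: "T (x + t) \<le> exp e * G x * E" .
      have "exp (- e) * G x * E = exp (- e / 2) * (exp (- e / 2) * G x * E)" by (simp flip: exp_add)
      also have "\<dots> \<le> exp (- e / 2) * (G (x + t) * E)"
        using o by (intro mult_left_mono mult_right_mono) (auto simp: E_def)
      also have "\<dots> \<le> T (x + t)" using 1 by (simp add: U_def E_def)
      finally show "exp (- e) * G x * exp (- (a * exp (p * (x + t)))) \<le> T (x + t) \<and>
          T (x + t) \<le> exp e * G x * exp (- (a * exp (p * (x + t))))"
        using ub by (simp add: E_def)
    qed
  qed
  then show ?thesis using d(1) by blast
qed

text \<open>The logarithm of the ratio tends to 0 and \<open>ln (G x)\<close> is negligible, so the
  double exponential alone decides. This makes the Chernoff bound available under the sharp
  hypotheses of (b).\<close>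

lemma log_tail_of_asymp_equiv:
  fixes T G :: "real \<Rightarrow> real"
  assumes T: "T \<sim>[at_top] (\<lambda>x. G x * exp (- (a * exp (p * x))))" and G: "\<forall>\<^sub>F x in at_top. G x > 0"
    and neg: "((\<lambda>x. ln (G x) / exp (p * x)) \<longlongrightarrow> 0) at_top" and p: "p > 0"
  shows "((\<lambda>x. ln (T x) / exp (p * x)) \<longlongrightarrow> - a) at_top"
proof -
  define U where "U x = G x * exp (- (a * exp (p * x)))" for x
  have r: "((\<lambda>x. T x / U x) \<longlongrightarrow> 1) at_top"
    unfolding U_def by (intro asymp_equivD_strong[OF T] eventually_mono[OF G]) simp
  have "((\<lambda>x. ln (T x / U x)) \<longlongrightarrow> ln 1) at_top"
    by (intro tendsto_ln r) simp
  then have "((\<lambda>x. ln (T x / U x) / exp (p * x)) \<longlongrightarrow> 0) at_top"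
    using p by (intro real_tendsto_divide_at_top) (simp, real_asymp)
  from tendsto_add[OF tendsto_add[OF this neg] tendsto_const[of "- a"]]
  have "((\<lambda>x. ln (T x / U x) / exp (p * x) + ln (G x) / exp (p * x) + - a) \<longlongrightarrow> - a) at_top" by simp
  moreover have "\<forall>\<^sub>F x in at_top. ln (T x / U x) / exp (p * x) + ln (G x) / exp (p * x) + - a = ln (T x) / exp (p * x)"
    using G order_tendstoD(1)[OF r zero_less_one]
  proof eventually_elim
    case (elim x)
    then have U: "U x > 0" by (simp add: U_def)
    then have Tp: "T x > 0" using elim by (simp add: zero_less_divide_iff)
    have "ln (U x) = ln (G x) - a * exp (p * x)"
      using elim by (simp add: U_def ln_mult)
    then have "ln (T x) = ln (T x / U x) + ln (G x) - a * exp (p * x)"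
      using U Tp by (simp add: ln_div)
    then show ?case by (simp add: add_divide_distrib diff_divide_distrib)
  qed
  ultimately show ?thesis by (rule Lim_transform_eventually)
qed

section \<open>Sharp asymptotics of the sum\<close>

context exp_tail_pair
begin

text \<open>The factor \<open>exp (l / 2)\<close> in \<open>R\<close> is the product of
  \<open>exp l\<close>, from differentiating the model tail, and \<open>exp (- l / 2)\<close>, the
  width of the Laplace peak when the large parameter is \<open>exp l\<close>.\<close>

lemma sum_tail_limit:
  fixes G1 G2 :: "real \<Rightarrow> real"
  assumes T1: "T1 \<sim>[at_top] (\<lambda>x. G1 x * exp (- (K / p1 * exp (p1 * x))))"
    and T2: "T2 \<sim>[at_top] (\<lambda>x. G2 x * exp (- (K / p2 * exp (p2 * x))))"
    and G1: "\<forall>\<^sub>F x in at_top. G1 x > 0" and G2: "\<forall>\<^sub>F x in at_top. G2 x > 0"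
    and loc1: "\<And>e. e > 0 \<Longrightarrow> \<exists>d>0. \<forall>\<^sub>F x in at_top. \<forall>t. \<bar>t\<bar> \<le> d \<longrightarrow> \<bar>ln (G1 (x + t)) - ln (G1 x)\<bar> \<le> e"
    and loc2: "\<And>e. e > 0 \<Longrightarrow> \<exists>d>0. \<forall>\<^sub>F x in at_top. \<forall>t. \<bar>t\<bar> \<le> d \<longrightarrow> \<bar>ln (G2 (x + t)) - ln (G2 x)\<bar> \<le> e"
    and neg1: "((\<lambda>x. ln (G1 x) / exp (p1 * x)) \<longlongrightarrow> 0) at_top"
    and neg2: "((\<lambda>x. ln (G2 x) / exp (p2 * x)) \<longlongrightarrow> 0) at_top"
  defines "R \<equiv> \<lambda>l. exp (l / 2) * G1 (l / p1) * G2 (l / p2) * exp (- B * exp l)"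
    and "D \<equiv> sqrt (2 * pi * K / (p1 + p2))"
  shows "((\<lambda>l. S l / R l) \<longlongrightarrow> D) at_top"
proof -
  note lim = filterlim_divide_at_top[OF pos(2)] filterlim_divide_at_top[OF pos(3)]
  note tail1 = log_tail_of_asymp_equiv[OF T1 G1 neg1 pos(2)]
  note tail2 = log_tail_of_asymp_equiv[OF T2 G2 neg2 pos(3)]
  note G1' = eventually_compose_filterlim[OF G1 lim(1)]
  note G2' = eventually_compose_filterlim[OF G2 lim(2)]
  have n1: "((\<lambda>l. ln (G1 (l / p1)) / exp l) \<longlongrightarrow> 0) at_top"
    using filterlim_compose[OF neg1 lim(1)] pos by simp
  have n2: "((\<lambda>l. ln (G2 (l / p2)) / exp l) \<longlongrightarrow> 0) at_top"
    using filterlim_compose[OF neg2 lim(2)] pos by simp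
  have D0: "D > 0" using pos by (simp add: D_def)
  define Z where "Z d l = exp (l / 2) * K * laplace d (exp l)" for d l
  have Z: "(Z d \<longlongrightarrow> D) at_top" if "d > 0" for d
  proof -
    have "((\<lambda>l. sqrt (exp l) * K * laplace d (exp l)) \<longlongrightarrow> D) at_top"
      using filterlim_compose[OF laplace_two_exponentials[OF pos that] exp_at_top]
      unfolding laplace_def excess_def D_def .
    moreover have "sqrt (exp l) = exp (l / 2)" for l :: real
      by (rule real_sqrt_unique) (simp_all add: power2_eq_square flip: exp_add)
    ultimately show ?thesis unfolding Z_def by simp
  qed
  \<comment> \<open>The witnesses depend on \<open>e\<close>, but \<open>Z d\<close> has the same
    limit \<open>D\<close> for every \<open>d > 0\<close> and the remaining terms vanish. Letting
    \<open>l\<close> tend to infinity therefore leaves only the powers of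
    \<open>exp e\<close>.\<close>
  have sandwich: "\<exists>d \<kappa> C. d > 0 \<and> \<kappa> > 0 \<and> (\<forall>\<^sub>F l in at_top.
      S l / R l \<le> exp (2 * e) * (exp (- 2 * \<kappa> * exp l) + Z d l) + C * exp (- (\<kappa> / 2) * exp l) \<and>
      exp (- e) * (exp (- e) * Z d l - exp e * exp (- 2 * \<kappa> * exp l)) \<le> S l / R l)"
    if e: "e > 0" for e
  proof -
    obtain d1 where d1: "d1 > 0" "\<forall>\<^sub>F x in at_top. \<forall>t. \<bar>t\<bar> \<le> d1 \<longrightarrow>
      exp (- e) * G1 x * exp (- (K / p1 * exp (p1 * (x + t)))) \<le> T1 (x + t) \<and>
      T1 (x + t) \<le> exp e * G1 x * exp (- (K / p1 * exp (p1 * (x + t))))"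
      using local_tail_bounds[OF T1 G1 loc1 e] by blast
    obtain d2 where d2: "d2 > 0" "\<forall>\<^sub>F x in at_top. \<forall>t. \<bar>t\<bar> \<le> d2 \<longrightarrow>
      exp (- e) * G2 x * exp (- (K / p2 * exp (p2 * (x + t)))) \<le> T2 (x + t) \<and>
      T2 (x + t) \<le> exp e * G2 x * exp (- (K / p2 * exp (p2 * (x + t))))"
      using local_tail_bounds[OF T2 G2 loc2 e] by blast
    define d where "d = min d1 d2"
    have d: "d > 0" "d \<le> d1" "d \<le> d2" using d1 d2 by (auto simp: d_def)
    \<comment> \<open>The quadratic lower bound makes the excess at least 2 * \<kappa> at distance
      \<open>d\<close> or more from the saddle point.\<close>
    define \<kappa> where "\<kappa> = K * min p1 p2 / 4 * d\<^sup>2"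
    have \<kappa>: "\<kappa> > 0" using pos d by (auto simp: \<kappa>_def)
    have ex: "2 * \<kappa> \<le> excess t" if "\<bar>t\<bar> \<ge> d" for t
    proof -
      have "d\<^sup>2 \<le> t\<^sup>2" using power_mono[OF that, of 2] d(1) by simp
      then have "K * min p1 p2 / 2 * d\<^sup>2 \<le> K * min p1 p2 / 2 * t\<^sup>2"
        using pos by (intro mult_left_mono) auto
      then show ?thesis using excess_ge[of t] by (simp add: \<kappa>_def)
    qed
    \<comment> \<open>Solves \<open>\<theta> * (B + 2 * \<kappa>) = B + \<kappa>\<close>: half of
      the gap is spent on having \<theta> < 1, the other half survives as decay beyond
      \<open>exp (- B * exp l)\<close>.\<close>
    define \<theta> where "\<theta> = (B + \<kappa>) / (B + 2 * \<kappa>)"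
    have \<theta>: "0 < \<theta>" "\<theta> < 1" "\<theta> * (B + 2 * \<kappa>) = B + \<kappa>"
      using B_pos \<kappa> by (auto simp: \<theta>_def)
    have W: "B + 2 * \<kappa> \<le> B + excess x" if "x \<in> - {-d<..d}" for x
      using ex[of x] that d(1) by (force simp: abs_if)
    have "- {-d<..d} \<in> sets borel" by simp
    then obtain C where C: "C > 0" "\<And>l. prob {\<omega>\<in>space M. l / p1 + l / p2 < X1 \<omega> + X2 \<omega> \<and> X2 \<omega> - l / p2 \<in> - {-d<..d}}
        \<le> C * exp (- \<theta> * (B + 2 * \<kappa>) * exp l)"
      using chernoff[OF tail1 tail2 \<theta>(1,2) _ W] by blast
    have S_split: "S l \<le> window d l + C * exp (- (B + \<kappa>) * exp l)" "window d l \<le> S l" for l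
    proof -
      have "S l = window d l + prob {\<omega>\<in>space M. l / p1 + l / p2 < X1 \<omega> + X2 \<omega> \<and> X2 \<omega> - l / p2 \<in> - {-d<..d}}"
        unfolding S_def window_def
        by (subst finite_measure_Union[symmetric]) (auto intro!: arg_cong[of _ _ prob])
      also have "\<dots> \<le> window d l + C * exp (- (\<theta> * (B + 2 * \<kappa>)) * exp l)"
        using C(2)[of l] by simp
      finally show "S l \<le> window d l + C * exp (- (B + \<kappa>) * exp l)" by (simp only: \<theta>(3))
      show "window d l \<le> S l"
        unfolding S_def window_def by (intro finite_measure_mono) auto
    qed
    \<comment> \<open>Each frozen factor is at least \<open>exp (- (\<kappa> / 4) * exp l)\<close>,
      so dividing by \<open>R l\<close> uses up at most \<kappa> / 2 of the surplus
      \<kappa>.\<close>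
    have "\<forall>\<^sub>F l in at_top. - (\<kappa> / 4) < ln (G1 (l / p1)) / exp l" "\<forall>\<^sub>F l in at_top. - (\<kappa> / 4) < ln (G2 (l / p2)) / exp l"
      using \<kappa> by (intro order_tendstoD(1)[OF n1] order_tendstoD(1)[OF n2]; simp)+
    then have "\<forall>\<^sub>F l in at_top.
      S l / R l \<le> exp (2 * e) * (exp (- 2 * \<kappa> * exp l) + Z d l) + C * exp (- (\<kappa> / 2) * exp l) \<and>
      exp (- e) * (exp (- e) * Z d l - exp e * exp (- 2 * \<kappa> * exp l)) \<le> S l / R l"
      using G1' G2' eventually_compose_filterlim[OF d1(2) lim(1)] eventually_compose_filterlim[OF d2(2) lim(2)]
        eventually_ge_at_top[of 0]
    proof eventually_elim
      case (elim l)
      define g1 g2 where "g1 = G1 (l / p1)" and "g2 = G2 (l / p2)"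
      have g: "g1 > 0" "g2 > 0" using elim(3,4) by (auto simp: g1_def g2_def)
      have Rp: "R l > 0" using g by (simp add: R_def g1_def g2_def)
      have R: "R l = exp (l / 2) * g1 * g2 * exp (- B * exp l)" by (simp add: R_def g1_def g2_def)
      have e1: "K / p1 * exp (p1 * (l / p1 + - t)) = exp l * (K / p1 * exp (- p1 * t))" for t
      proof -
        have "p1 * (l / p1 + - t) = l + - p1 * t" using pos by (simp add: field_simps)
        then show ?thesis by (simp only: exp_add mult.left_commute)
      qed
      have e2: "K / p2 * exp (p2 * (l / p2 + t)) = exp l * (K / p2 * exp (p2 * t))" for t
      proof -
        have "p2 * (l / p2 + t) = l + p2 * t" using pos by (simp add: field_simps)
        then show ?thesis by (simp only: exp_add mult.left_commute)
      qed
      have b1: "exp (- e) * g1 * exp (- exp l * (K / p1 * exp (- p1 * t))) \<le> T1 (l / p1 - t)"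
          "T1 (l / p1 - t) \<le> exp e * g1 * exp (- exp l * (K / p1 * exp (- p1 * t)))" if "\<bar>t\<bar> \<le> d" for t
        using elim(5)[rule_format, of "- t"] that d unfolding e1 by (auto simp: g1_def)
      have b2: "exp (- e) * g2 * exp (- exp l * (K / p2 * exp (p2 * t))) \<le> T2 (l / p2 + t)"
          "T2 (l / p2 + t) \<le> exp e * g2 * exp (- exp l * (K / p2 * exp (p2 * t)))" if "\<bar>t\<bar> \<le> d" for t
        using elim(6)[rule_format, of t] that d unfolding e2 by (auto simp: g2_def)
      \<comment> \<open>The factor \<open>exp (l / 2)\<close> is at least 1 for
        \<open>l \<ge> 0\<close>; inserting it makes the edge terms multiples of
        \<open>R l\<close>.\<close>
      have edge: "exp (- exp l * (B + excess t)) \<le> exp (l / 2) * exp (- B * exp l) * exp (- 2 * \<kappa> * exp l)"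
        if "\<bar>t\<bar> \<ge> d" for t
      proof -
        have "exp l * (2 * \<kappa>) \<le> exp l * excess t" using ex[OF that] by (intro mult_left_mono) auto
        moreover have "- exp l * (B + excess t) = - B * exp l - exp l * excess t"
            "- 2 * \<kappa> * exp l = - (exp l * (2 * \<kappa>))"
          by (simp_all add: algebra_simps)
        ultimately have "- exp l * (B + excess t) \<le> l / 2 + - B * exp l + - 2 * \<kappa> * exp l"
          using elim(7) by linarith
        then show ?thesis by (simp only: exp_add[symmetric] exp_le_cancel_iff)
      qed
      have ZR: "exp l * K * exp (- B * exp l) * laplace d (exp l) = exp (l / 2) * exp (- B * exp l) * Z d l"
      proof -
        have eq: "exp (l / 2) * exp (l / 2) = exp l" by (simp flip: exp_add)
        have "exp (l / 2) * exp (- B * exp l) * Z d l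
            = (exp (l / 2) * exp (l / 2)) * K * exp (- B * exp l) * laplace d (exp l)"
          unfolding Z_def by (simp only: mult_ac)
        then show ?thesis by (simp only: eq)
      qed
      let ?w = "exp (l / 2) * exp (- B * exp l)"
      have "window d l \<le> exp e * g1 * (exp e * g2 * exp (- exp l * (B + excess (- d)))
          + exp e * g2 * exp l * K * exp (- B * exp l) * laplace d (exp l))"
        using d g by (intro window_upper[where H' = 0] b1(2) b2(2)) auto
      also have "\<dots> = exp e * g1 * (exp e * g2 * exp (- exp l * (B + excess (- d)))
          + exp e * g2 * (?w * Z d l))"
        unfolding ZR[symmetric] by (simp only: mult.assoc)
      also have "\<dots> \<le> exp e * g1 * (exp e * g2 * (?w * exp (- 2 * \<kappa> * exp l)) + exp e * g2 * (?w * Z d l))"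
        using g edge[of "- d"] d by (intro mult_left_mono add_right_mono) auto
      also have "\<dots> = exp (2 * e) * (exp (- 2 * \<kappa> * exp l) + Z d l) * R l"
      proof -
        have "exp (2 * e) = exp e * exp e" by (simp flip: exp_add)
        then show ?thesis by (simp add: R algebra_simps)
      qed
      finally have up: "window d l \<le> exp (2 * e) * (exp (- 2 * \<kappa> * exp l) + Z d l) * R l" .
      have off: "C * exp (- (B + \<kappa>) * exp l) \<le> C * exp (- (\<kappa> / 2) * exp l) * R l"
      proof -
        have "- (\<kappa> / 4) * exp l \<le> ln g1" "- (\<kappa> / 4) * exp l \<le> ln g2"
          using elim(1,2) by (simp_all add: g1_def g2_def pos_less_divide_eq)
        then have "- (B + \<kappa>) * exp l \<le> - (\<kappa> / 2) * exp l + (l / 2 + ln g1 + ln g2 + - B * exp l)"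
          using elim(7) by (simp add: algebra_simps)
        then have "exp (- (B + \<kappa>) * exp l) \<le> exp (- (\<kappa> / 2) * exp l + (l / 2 + ln g1 + ln g2 + - B * exp l))"
          by (simp only: exp_le_cancel_iff)
        also have "\<dots> = exp (- (\<kappa> / 2) * exp l) * R l"
          using g by (simp only: exp_add R exp_ln)
        finally show ?thesis using C(1) by simp
      qed
      have "S l \<le> (exp (2 * e) * (exp (- 2 * \<kappa> * exp l) + Z d l) + C * exp (- (\<kappa> / 2) * exp l)) * R l"
        using S_split(1)[of l] up off by (simp add: distrib_right)
      moreover have "exp (- e) * (exp (- e) * Z d l - exp e * exp (- 2 * \<kappa> * exp l)) * R l \<le> S l"
      proof -
        have "exp (- e) * (exp (- e) * Z d l - exp e * exp (- 2 * \<kappa> * exp l)) * R l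
          = exp (- e) * g1 * (exp (- e) * g2 * (?w * Z d l) - exp e * g2 * (?w * exp (- 2 * \<kappa> * exp l)))"
          by (simp add: R algebra_simps)
        also have "\<dots> \<le> exp (- e) * g1 * (exp (- e) * g2 * (?w * Z d l) - exp e * g2 * exp (- exp l * (B + excess d)))"
          using g edge[of d] d by (intro mult_left_mono diff_left_mono) auto
        also have "\<dots> = exp (- e) * g1 * (exp (- e) * g2 * exp l * K * exp (- B * exp l) * laplace d (exp l) - exp e * g2 * exp (- exp l * (B + excess d)))"
          unfolding ZR[symmetric] by (simp only: mult.assoc)
        also have "\<dots> \<le> window d l"
          using d g by (intro window_lower b1(1) b2) auto
        also have "\<dots> \<le> S l" by (rule S_split)
        finally show ?thesis .
      qed
      ultimately show ?case using Rp by (simp add: pos_divide_le_eq pos_le_divide_eq)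
    qed
    then show ?thesis using d(1) \<kappa> by blast
  qed
  show ?thesis
  proof (rule order_tendstoI)
    fix y assume y: "y < D"
    have "((\<lambda>e :: real. exp (- e) * (exp (- e) * D)) \<longlongrightarrow> exp (- 0) * (exp (- 0) * D)) (at_right 0)"
      by (intro tendsto_intros)
    then have "\<forall>\<^sub>F e in at_right 0. y < exp (- e) * (exp (- e) * D)"
      using y by (intro order_tendstoD) simp_all
    with eventually_at_right_less[of "0 :: real"]
    have "\<forall>\<^sub>F e in at_right 0. 0 < e \<and> y < exp (- e) * (exp (- e) * D)"
      by (rule eventually_conj)
    then obtain e where e: "e > 0" "y < exp (- e) * (exp (- e) * D)"
      using eventually_happens'[OF trivial_limit_at_right_real] by blast
    obtain d \<kappa> C where d: "d > 0" "\<kappa> > 0" and b: "\<forall>\<^sub>F l in at_top.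
        S l / R l \<le> exp (2 * e) * (exp (- 2 * \<kappa> * exp l) + Z d l) + C * exp (- (\<kappa> / 2) * exp l) \<and>
        exp (- e) * (exp (- e) * Z d l - exp e * exp (- 2 * \<kappa> * exp l)) \<le> S l / R l"
      using sandwich[OF e(1)] by blast
    have "((\<lambda>l. exp (- 2 * \<kappa> * exp l)) \<longlongrightarrow> 0) at_top" using d(2) by real_asymp
    then have "((\<lambda>l. exp (- e) * (exp (- e) * Z d l - exp e * exp (- 2 * \<kappa> * exp l)))
        \<longlongrightarrow> exp (- e) * (exp (- e) * D - exp e * 0)) at_top"
      by (intro tendsto_intros Z d)
    then have "\<forall>\<^sub>F l in at_top. y < exp (- e) * (exp (- e) * Z d l - exp e * exp (- 2 * \<kappa> * exp l))"
      using e(2) by (intro order_tendstoD(1)) auto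
    with b show "\<forall>\<^sub>F l in at_top. y < S l / R l" by eventually_elim linarith
  next
    fix y assume y: "D < y"
    have "((\<lambda>e :: real. exp (2 * e) * D) \<longlongrightarrow> exp (2 * 0) * D) (at_right 0)"
      by (intro tendsto_intros)
    then have "\<forall>\<^sub>F e in at_right 0. exp (2 * e) * D < y"
      using y by (intro order_tendstoD) simp_all
    with eventually_at_right_less[of "0 :: real"]
    have "\<forall>\<^sub>F e in at_right 0. 0 < e \<and> exp (2 * e) * D < y"
      by (rule eventually_conj)
    then obtain e where e: "e > 0" "exp (2 * e) * D < y"
      using eventually_happens'[OF trivial_limit_at_right_real] by blast
    obtain d \<kappa> C where d: "d > 0" "\<kappa> > 0" and b: "\<forall>\<^sub>F l in at_top.
        S l / R l \<le> exp (2 * e) * (exp (- 2 * \<kappa> * exp l) + Z d l) + C * exp (- (\<kappa> / 2) * exp l) \<and>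
        exp (- e) * (exp (- e) * Z d l - exp e * exp (- 2 * \<kappa> * exp l)) \<le> S l / R l"
      using sandwich[OF e(1)] by blast
    have "((\<lambda>l. exp (- 2 * \<kappa> * exp l)) \<longlongrightarrow> 0) at_top" "((\<lambda>l. exp (- (\<kappa> / 2) * exp l)) \<longlongrightarrow> 0) at_top"
      using d(2) by real_asymp+
    then have "((\<lambda>l. exp (2 * e) * (exp (- 2 * \<kappa> * exp l) + Z d l) + C * exp (- (\<kappa> / 2) * exp l))
        \<longlongrightarrow> exp (2 * e) * (0 + D) + C * 0) at_top"
      by (intro tendsto_intros Z d)
    then have "\<forall>\<^sub>F l in at_top. exp (2 * e) * (exp (- 2 * \<kappa> * exp l) + Z d l) + C * exp (- (\<kappa> / 2) * exp l) < y"
      using e(2) by (intro order_tendstoD(2)) auto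
    with b show "\<forall>\<^sub>F l in at_top. S l / R l < y" by eventually_elim linarith
  qed
qed

end

subsection \<open>Products\<close>

text \<open>Composition with \<open>exp\<close> turns dilations into translations, so
  \<open>ln (G x)\<close> has increments over \<open>t\<close> tending to \<rho> * t. The scale
  \<open>a\<close> absorbs the shifts by \<open>ln A\<close>.\<close>

lemma regularly_varying_exp:
  fixes g :: "real \<Rightarrow> real"
  assumes g: "regularly_varying g" and a: "a > 0"
  defines "G \<equiv> \<lambda>x. g (a * exp x)"
  shows "\<forall>\<^sub>F x in at_top. G x > 0"
    and "e > 0 \<Longrightarrow> \<exists>d>0. \<forall>\<^sub>F x in at_top. \<forall>t. \<bar>t\<bar> \<le> d \<longrightarrow> \<bar>ln (G (x + t)) - ln (G x)\<bar> \<le> e"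
    and "p > 0 \<Longrightarrow> ((\<lambda>x. ln (G x) / exp (p * x)) \<longlongrightarrow> 0) at_top"
proof -
  from g obtain \<rho> where [measurable]: "g \<in> borel_measurable borel" and gp: "\<forall>\<^sub>F u in at_top. g u > 0"
    and lim: "\<And>t. t > 0 \<Longrightarrow> ((\<lambda>u. g (t * u) / g u) \<longlongrightarrow> t powr \<rho>) at_top"
    unfolding regularly_varying_def by blast
  have top: "filterlim (\<lambda>x. a * exp x) at_top at_top" using a by real_asymp
  show Gp: "\<forall>\<^sub>F x in at_top. G x > 0"
    unfolding G_def by (rule eventually_compose_filterlim[OF gp top])
  have m: "(\<lambda>x. ln (G x)) \<in> borel_measurable borel"
    unfolding G_def by measurable
  have inc: "((\<lambda>x. ln (G (x + t)) - ln (G x)) \<longlongrightarrow> \<rho> * t) at_top" for t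
  proof -
    have "((\<lambda>x. G (x + t) / G x) \<longlongrightarrow> exp t powr \<rho>) at_top"
      using filterlim_compose[OF lim[of "exp t"] top] by (simp add: G_def exp_add mult_ac)
    then have "((\<lambda>x. ln (G (x + t) / G x)) \<longlongrightarrow> ln (exp t powr \<rho>)) at_top"
      by (intro tendsto_ln) auto
    moreover have "ln (exp t powr \<rho>) = \<rho> * t" by (simp add: ln_powr)
    moreover have "filterlim (\<lambda>x. x + t) at_top at_top" by real_asymp
    from eventually_compose_filterlim[OF Gp this] Gp
    have "\<forall>\<^sub>F x in at_top. ln (G (x + t) / G x) = ln (G (x + t)) - ln (G x)"
      by eventually_elim (simp add: ln_div)
    ultimately show ?thesis using Lim_transform_eventually by fastforce
  qed
  show "e > 0 \<Longrightarrow> \<exists>d>0. \<forall>\<^sub>F x in at_top. \<forall>t. \<bar>t\<bar> \<le> d \<longrightarrow> \<bar>ln (G (x + t)) - ln (G x)\<bar> \<le> e"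
    by (rule regular_increments_locally_uniform[OF m inc])
  show "p > 0 \<Longrightarrow> ((\<lambda>x. ln (G x) / exp (p * x)) \<longlongrightarrow> 0) at_top"
    by (rule regular_increments_negligible[OF m inc])
qed

lemma powr_scaled_exp: "a > 0 \<Longrightarrow> (a * exp x) powr p = a powr p * exp (p * x)" for a :: real
  by (simp add: powr_mult exp_powr_real mult.commute)

lemma log_tail_exp:
  fixes P :: "real \<Rightarrow> real"
  assumes "((\<lambda>u. ln (P u) / u powr p) \<longlongrightarrow> - L) at_top" and a: "a > 0"
  shows "((\<lambda>x. ln (P (a * exp x)) / exp (p * x)) \<longlongrightarrow> - (L * a powr p)) at_top"
proof -
  have "filterlim (\<lambda>x. a * exp x) at_top at_top" using a by real_asymp
  from tendsto_mult_right[OF filterlim_compose[OF assms(1) this], of "a powr p"]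
  show ?thesis using a by (simp add: powr_scaled_exp mult_ac)
qed

lemma tail_equiv_exp:
  fixes P g :: "real \<Rightarrow> real"
  assumes "P \<sim>[at_top] (\<lambda>u. g u * exp (- L * u powr p))" and a: "a > 0"
  shows "(\<lambda>x. P (a * exp x)) \<sim>[at_top] (\<lambda>x. g (a * exp x) * exp (- (L * a powr p * exp (p * x))))"
proof -
  have "filterlim (\<lambda>x. a * exp x) at_top at_top" using a by real_asymp
  from asymp_equiv_compose'[OF assms(1) this] 
  show ?thesis using a by (simp add: powr_scaled_exp mult_ac)
qed

theorem theorem2p1:
  fixes M :: "'a measure" and Y1 Y2 :: "'a \<Rightarrow> real" and L1 L2 p1 p2 :: real
  assumes "prob_space M"
    and "Y1 \<in> borel_measurable M" and "Y2 \<in> borel_measurable M"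
    and "prob_space.indep_var M borel Y1 borel Y2"
    and "\<forall>x\<in>space M. Y1 x > 0" and "\<forall>x\<in>space M. Y2 x > 0"
    and "L1 > 0" and "L2 > 0" and "p1 > 0" and "p2 > 0"
  defines "A \<equiv> ((p1 * L1) / (p2 * L2)) powr (1 / (p1 + p2))"
  defines "B \<equiv> L1 * A powr (- p1) + L2 * A powr p2"
  defines "c \<equiv> (\<lambda>u::real. A * u powr (p1 / (p1 + p2)))"
  defines "D \<equiv> sqrt (2 * pi * (p1 * L1) powr (p2 / (p1 + p2)) * (p2 * L2) powr (p1 / (p1 + p2))
                      / (p1 + p2))"
  shows
    "(((\<lambda>u. ln (measure M {x\<in>space M. Y1 x > u}) / u powr p1) \<longlongrightarrow> - L1) at_top \<and>
      ((\<lambda>u. ln (measure M {x\<in>space M. Y2 x > u}) / u powr p2) \<longlongrightarrow> - L2) at_top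
      \<longrightarrow> ((\<lambda>u. ln (measure M {x\<in>space M. Y1 x * Y2 x > u}) / u powr (p1 * p2 / (p1 + p2)))
             \<longlongrightarrow> - B) at_top)
     \<and>
     (\<forall>g1 g2 :: real \<Rightarrow> real.
        regularly_varying g1 \<and> regularly_varying g2 \<and>
        (\<lambda>u. measure M {x\<in>space M. Y1 x > u}) \<sim>[at_top] (\<lambda>u. g1 u * exp (- L1 * u powr p1)) \<and>
        (\<lambda>u. measure M {x\<in>space M. Y2 x > u}) \<sim>[at_top] (\<lambda>u. g2 u * exp (- L2 * u powr p2))
        \<longrightarrow>
        (\<lambda>u. measure M {x\<in>space M. Y1 x * Y2 x > u}) \<sim>[at_top]
          (\<lambda>u. D * u powr (p1 * p2 / (2 * (p1 + p2))) * g1 (u / c u) * g2 (c u)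
                 * exp (- B * u powr (p1 * p2 / (p1 + p2)))) \<and>
        (\<lambda>u. D * u powr (p1 * p2 / (2 * (p1 + p2))) * g1 (u / c u) * g2 (c u)
                 * exp (- B * u powr (p1 * p2 / (p1 + p2)))) \<sim>[at_top]
          (\<lambda>u. D * u powr (p1 * p2 / (2 * (p1 + p2)))
                 * measure M {x\<in>space M. Y1 x > u / c u} * measure M {x\<in>space M. Y2 x > c u}))"
proof -
  interpret prob_space M by fact
  note pos = assms(7-10)
  have A: "A > 0" using pos by (simp add: A_def)
  define P1 where "P1 u = prob {x\<in>space M. u < Y1 x}" for u
  define P2 where "P2 u = prob {x\<in>space M. u < Y2 x}" for u
  define P12 where "P12 u = prob {x\<in>space M. u < Y1 x * Y2 x}" for u
  \<comment> \<open>The value of \<open>A\<close> is the solution of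
    \<open>p1 * L1 * A powr (- p1) = p2 * L2 * A powr p2\<close>, and \<open>K\<close> is this
    common value.\<close>
  define K where "K = p1 * L1 * A powr (- p1)"
  \<comment> \<open>Chosen so that \<open>q / p1 + q / p2 = 1\<close>: with
    \<open>l = q * ln u\<close> the threshold \<open>l / p1 + l / p2\<close> becomes
    \<open>ln u\<close>.\<close>
  define q where "q = p1 * p2 / (p1 + p2)"
  have q: "q > 0" using pos by (simp add: q_def)
  have q1: "q / p1 = p2 / (p1 + p2)" and q2: "q / p2 = p1 / (p1 + p2)" and qh: "q / 2 = p1 * p2 / (2 * (p1 + p2))"
    using pos by (simp_all add: q_def)
  have q12: "q / p1 + q / p2 = 1"
    using pos unfolding q1 q2 by (simp add: add.commute flip: add_divide_distrib)
  have K0: "K > 0" using pos A by (simp add: K_def)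
  have Apow: "A powr (p1 + p2) = (p1 * L1) / (p2 * L2)"
    using pos by (simp add: A_def powr_powr)
  have K2: "K = p2 * L2 * A powr p2"
  proof -
    have "A powr (p1 + p2) * A powr (- p1) = A powr p2" by (simp flip: powr_add)
    then show ?thesis using pos unfolding Apow K_def by (simp add: field_simps)
  qed
  have KL: "K / p1 = L1 * A powr (- p1)" "K / p2 = L2 * A powr p2"
    using pos by (simp add: K_def, simp add: K2)
  \<comment> \<open>Eliminating \<open>A\<close> exhibits \<open>K\<close> as a weighted geometric
    mean of \<open>p1 * L1\<close> and \<open>p2 * L2\<close>, the expression under the root in
    \<open>D\<close>.\<close>
  have KD: "D = sqrt (2 * pi * K / (p1 + p2))"
  proof -
    have "A powr (- p1) = (p1 * L1) powr (- (p1 / (p1 + p2))) * (p2 * L2) powr (p1 / (p1 + p2))"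
      using pos by (simp add: A_def powr_powr powr_divide powr_minus field_simps)
    then have "K = (p1 * L1) powr 1 * (p1 * L1) powr (- (p1 / (p1 + p2))) * (p2 * L2) powr (p1 / (p1 + p2))"
      using pos by (simp add: K_def)
    also have "\<dots> = (p1 * L1) powr (1 + - (p1 / (p1 + p2))) * (p2 * L2) powr (p1 / (p1 + p2))"
      by (simp only: powr_add)
    also have "1 + - (p1 / (p1 + p2)) = p2 / (p1 + p2)" using pos by (simp add: field_simps)
    finally show ?thesis by (simp add: D_def mult_ac)
  qed
  \<comment> \<open>The opposite shifts by \<open>ln A\<close> cancel in the sum, so
    \<open>X1 + X2\<close> is still the logarithm of the product.\<close>
  define X1 where "X1 = (\<lambda>y. ln y + ln A) \<circ> Y1"
  define X2 where "X2 = (\<lambda>y. ln y - ln A) \<circ> Y2"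
  have "indep_var borel X1 borel X2"
    unfolding X1_def X2_def by (rule indep_var_compose[OF assms(4)]) simp_all
  then interpret E: exp_tail_pair M X1 X2 K p1 p2
    using K0 pos by unfold_locales auto
  have T1: "E.T1 x = P1 (1 / A * exp x)" for x
    unfolding E.T1_def P1_def
  proof (intro arg_cong[of _ _ prob] Collect_cong conj_cong refl)
    fix w assume "w \<in> space M"
    then have "Y1 w > 0" using assms by simp
    have "x < X1 w \<longleftrightarrow> x - ln A < ln (Y1 w)" by (auto simp: X1_def)
    also have "\<dots> \<longleftrightarrow> exp (x - ln A) < Y1 w" using \<open>Y1 w > 0\<close> by (subst exp_less_cancel_iff[symmetric]) simp
    also have "exp (x - ln A) = 1 / A * exp x" using A by (simp add: exp_diff)
    finally show "x < X1 w \<longleftrightarrow> 1 / A * exp x < Y1 w" .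
  qed
  have T2: "E.T2 x = P2 (A * exp x)" for x
    unfolding E.T2_def P2_def
  proof (intro arg_cong[of _ _ prob] Collect_cong conj_cong refl)
    fix w assume "w \<in> space M"
    then have "Y2 w > 0" using assms by simp
    have "x < X2 w \<longleftrightarrow> ln A + x < ln (Y2 w)" by (auto simp: X2_def)
    also have "\<dots> \<longleftrightarrow> exp (ln A + x) < Y2 w" using \<open>Y2 w > 0\<close> by (subst exp_less_cancel_iff[symmetric]) simp
    also have "exp (ln A + x) = A * exp x" using A by (simp add: exp_add)
    finally show "x < X2 w \<longleftrightarrow> A * exp x < Y2 w" .
  qed
  have S: "E.S (q * ln u) = P12 u" if "u > 0" for u
    unfolding E.S_def P12_def
  proof (intro arg_cong[of _ _ prob] Collect_cong conj_cong refl)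
    fix w assume "w \<in> space M"
    then have Y: "Y1 w > 0" "Y2 w > 0" using assms by simp_all
    have "q * ln u / p1 + q * ln u / p2 = (q / p1 + q / p2) * ln u" by (simp add: algebra_simps)
    then have "q * ln u / p1 + q * ln u / p2 = ln u" by (simp add: q12)
    moreover have "X1 w + X2 w = ln (Y1 w * Y2 w)" using Y by (simp add: X1_def X2_def ln_mult)
    ultimately show "q * ln u / p1 + q * ln u / p2 < X1 w + X2 w \<longleftrightarrow> u < Y1 w * Y2 w"
      using Y that by simp
  qed
  have EB: "E.B = B" unfolding E.B_def B_def KL ..
  have top: "filterlim (\<lambda>u. q * ln u) at_top at_top" using q by real_asymp
  have eq: "exp (q * ln u) = u powr q" "exp (q * ln u / 2) = u powr (q / 2)" if "u > 0" for u
    using that by (simp_all add: powr_def)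
  have Ainv: "(1 / A) powr p1 = A powr (- p1)"
    using A by (simp add: powr_divide powr_minus_divide)
  \<comment> \<open>The saddle point \<open>X2 = l / p2\<close>, \<open>X1 = l / p1\<close>
    translates back into \<open>Y2 = c u\<close>, \<open>Y1 = u / c u\<close>.\<close>
  have cu: "1 / A * exp (q * ln u / p1) = u / c u" "A * exp (q * ln u / p2) = c u" if "u > 0" for u
  proof -
    show 2: "A * exp (q * ln u / p2) = c u"
      using that unfolding c_def q2[symmetric] by (simp add: powr_def)
    have "exp (q * ln u / p1) * exp (q * ln u / p2) = exp ((q / p1 + q / p2) * ln u)"
      by (simp add: algebra_simps flip: exp_add)
    also have "\<dots> = u" using that by (simp add: q12)
    finally have "exp (q * ln u / p1) = u / exp (q * ln u / p2)"
      by (simp add: field_simps)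
    then show "1 / A * exp (q * ln u / p1) = u / c u" using A unfolding 2[symmetric] by simp
  qed
  have a: "((\<lambda>u. ln (P12 u) / u powr q) \<longlongrightarrow> - B) at_top"
    if "((\<lambda>u. ln (P1 u) / u powr p1) \<longlongrightarrow> - L1) at_top" "((\<lambda>u. ln (P2 u) / u powr p2) \<longlongrightarrow> - L2) at_top"
  proof -
    have "((\<lambda>l. ln (E.S l) / exp l) \<longlongrightarrow> - E.B) at_top"
    proof (rule E.log_tail_sum)
      show "((\<lambda>x. ln (E.T1 x) / exp (p1 * x)) \<longlongrightarrow> - (K / p1)) at_top"
        using log_tail_exp[OF that(1), of "1 / A"] A unfolding T1 KL Ainv by simp
      show "((\<lambda>x. ln (E.T2 x) / exp (p2 * x)) \<longlongrightarrow> - (K / p2)) at_top"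
        using log_tail_exp[OF that(2), of A] A unfolding T2 KL by simp
    qed
    from filterlim_compose[OF this top] show ?thesis
      unfolding EB
      by (rule Lim_transform_eventually)
        (use eventually_gt_at_top[of 0] in \<open>eventually_elim, simp add: S eq\<close>)
  qed
  have b: "P12 \<sim>[at_top] (\<lambda>u. D * u powr (q / 2) * g1 (u / c u) * g2 (c u) * exp (- B * u powr q)) \<and>
      (\<lambda>u. D * u powr (q / 2) * g1 (u / c u) * g2 (c u) * exp (- B * u powr q)) \<sim>[at_top]
        (\<lambda>u. D * u powr (q / 2) * P1 (u / c u) * P2 (c u))"
    if g: "regularly_varying g1" "regularly_varying g2"
      and t1: "P1 \<sim>[at_top] (\<lambda>u. g1 u * exp (- L1 * u powr p1))"
      and t2: "P2 \<sim>[at_top] (\<lambda>u. g2 u * exp (- L2 * u powr p2))" for g1 g2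
  proof
    have A': "1 / A > 0" using A by simp
    note v1 = regularly_varying_exp[OF g(1) A'] and v2 = regularly_varying_exp[OF g(2) A]
    have e1: "E.T1 \<sim>[at_top] (\<lambda>x. g1 (1 / A * exp x) * exp (- (K / p1 * exp (p1 * x))))"
      using tail_equiv_exp[OF t1 A'] unfolding T1[abs_def] KL Ainv .
    have e2: "E.T2 \<sim>[at_top] (\<lambda>x. g2 (A * exp x) * exp (- (K / p2 * exp (p2 * x))))"
      using tail_equiv_exp[OF t2 A] unfolding T2[abs_def] KL .
    have lim: "((\<lambda>l. E.S l / (exp (l / 2) * g1 (1 / A * exp (l / p1)) * g2 (A * exp (l / p2)) * exp (- B * exp l)))
        \<longlongrightarrow> D) at_top"
      unfolding KD EB[symmetric]
      by (rule E.sum_tail_limit[OF e1 e2 v1(1) v2(1) v1(2) v2(2) v1(3)[OF pos(3)] v2(3)[OF pos(4)]])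
    have D0: "D > 0" using pos K0 by (simp add: KD)
    have "((\<lambda>u. P12 u / (u powr (q / 2) * g1 (u / c u) * g2 (c u) * exp (- B * u powr q))) \<longlongrightarrow> D) at_top"
      using filterlim_compose[OF lim top]
      by (rule Lim_transform_eventually)
        (use eventually_gt_at_top[of 0] in \<open>eventually_elim, simp only: S eq cu\<close>)
    from tendsto_divide[OF this tendsto_const[of D]] D0
    show "P12 \<sim>[at_top] (\<lambda>u. D * u powr (q / 2) * g1 (u / c u) * g2 (c u) * exp (- B * u powr q))"
      by (intro asymp_equivI') (simp add: mult_ac)
    have tops: "filterlim (\<lambda>u. q * ln u / p1) at_top at_top" "filterlim (\<lambda>u. q * ln u / p2) at_top at_top"
      using q pos by real_asymp+
    \<comment> \<open>The second equivalence needs no further analysis: the two tail equivalences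
      are multiplied at the saddle point, where the exponents \<open>K / p1 * u powr q\<close> and
      \<open>K / p2 * u powr q\<close> add up to \<open>B * u powr q\<close>.\<close>
    have "(\<lambda>u. D * u powr (q / 2) * E.T1 (q * ln u / p1) * E.T2 (q * ln u / p2)) \<sim>[at_top]
        (\<lambda>u. D * u powr (q / 2) * (g1 (1 / A * exp (q * ln u / p1)) * exp (- (K / p1 * exp (p1 * (q * ln u / p1)))))
           * (g2 (A * exp (q * ln u / p2)) * exp (- (K / p2 * exp (p2 * (q * ln u / p2))))))"
      by (intro asymp_equiv_mult asymp_equiv_refl asymp_equiv_compose'[OF e1 tops(1)] asymp_equiv_compose'[OF e2 tops(2)])
    also have "?this \<longleftrightarrow> (\<lambda>u. D * u powr (q / 2) * P1 (u / c u) * P2 (c u)) \<sim>[at_top]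
        (\<lambda>u. D * u powr (q / 2) * g1 (u / c u) * g2 (c u) * exp (- B * u powr q))"
    proof (rule asymp_equiv_cong)
      show "\<forall>\<^sub>F u in at_top. D * u powr (q / 2) * E.T1 (q * ln u / p1) * E.T2 (q * ln u / p2)
          = D * u powr (q / 2) * P1 (u / c u) * P2 (c u)"
        using eventually_gt_at_top[of 0] by eventually_elim (simp only: T1 T2 cu)
      show "\<forall>\<^sub>F u in at_top. D * u powr (q / 2) * (g1 (1 / A * exp (q * ln u / p1)) * exp (- (K / p1 * exp (p1 * (q * ln u / p1)))))
           * (g2 (A * exp (q * ln u / p2)) * exp (- (K / p2 * exp (p2 * (q * ln u / p2)))))
          = D * u powr (q / 2) * g1 (u / c u) * g2 (c u) * exp (- B * u powr q)"
        using eventually_gt_at_top[of 0]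
      proof eventually_elim
        case (elim u)
        have "exp (- B * u powr q) = exp (- (K / p1 * u powr q)) * exp (- (K / p2 * u powr q))"
          unfolding EB[symmetric] E.B_def by (simp add: algebra_simps flip: exp_add)
        moreover have "exp (p1 * (q * ln u / p1)) = u powr q" "exp (p2 * (q * ln u / p2)) = u powr q"
          using pos elim by (simp_all add: powr_def)
        ultimately show ?case unfolding cu[OF elim] by (simp only: mult_ac)
      qed
    qed
    finally show "(\<lambda>u. D * u powr (q / 2) * g1 (u / c u) * g2 (c u) * exp (- B * u powr q)) \<sim>[at_top]
        (\<lambda>u. D * u powr (q / 2) * P1 (u / c u) * P2 (c u))"
      by (rule asymp_equiv_symI)
  qed
  show ?thesis
    using a b unfolding P1_def[abs_def] P2_def[abs_def] P12_def[abs_def] q_def[symmetric] qh[symmetric]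
    by blast
qed

end
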